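(* Let $q$ be a power of a prime $p$, $\ell$ an odd prime different from $p$, and $n$ a positive integer not divisible by $p$ and not divisible by $\ell$. Let $\mathcal{CR}_n$ be a full set of representatives of the $q$-cyclotomic cosets modulo $n$. Then the $\ell$-adic $q$-cyclotomic system $\mathcal{PC}_n^\ell$ can be decomposed as $$\mathcal{PC}_n^\ell=\bigsqcup_{\gamma\in\mathcal{CR}_n}\Bigl(\bigsqcup_{m\in\mathbb{N}\cup\{\infty\}}\mathcal{PC}_n^\ell(\gamma;m)\Bigr).$$ Furthermore: (1) The sequences lying in $\mathcal{PC}_n^\ell(\gamma;\infty)$, $\gamma\in\mathcal{CR}_n$, are exactly the sequences that are splitting or semi-splitting (at every degree). (2) Let $\gamma\in\mathcal{CR}_n$ with $\tau=|c_n(\gamma)|$, and let $v=v_\ell(q^\tau-1)$ if $\ell\mid q^\tau-1$ and $v=v_\ell(q^{\tau\cdot\mathrm{ord}_\ell(q^\tau)}-1)$ if $\ell\nmid q^\tau-1$. If $\ell\mid q^\tau-1$, then for any $m\in\mathbb{N}$, each sequence lying in $\mathcal{PC}_n^\ell(\gamma;m)$ is splitting at degree $i\leq m+v-1$, while it is stable at degree $i\geq m+v$. If $\ell\nmid q^\tau-1$, then for any $m\in\mathbb{N}$, each sequence in $\mathcal{PC}_n^\ell(\gamma;m)$ is semi-splitting at degree $i\leq m-1$, splitting at degree $m\leq i\leq m+v-1$, and nonsplitting at degree $i\geq m+v$.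
   Context: Notation: $\mathbb{N}=\{0,1,2,\dots\}$; $[a,b]$ is the set of integers from $a$ to $b$; $v_\ell$ is the $\ell$-adic valuation ($v_\ell(0)=\infty$); $\mathrm{ord}_\ell(x)$ is the multiplicative order of $x$ modulo $\ell$. Cyclotomic cosets. For $M\geq1$ coprime to $q$ and $\gamma\in\mathbb{Z}$, the $q$-cyclotomic coset modulo $M$ containing $\gamma$ is $c_M(\gamma)=\{\gamma,\gamma q,\dots,\gamma q^{\tau-1}\}\subseteq\mathbb{Z}/M\mathbb{Z}$, where $\tau$ is the least positive integer with $\gamma q^\tau\equiv\gamma\pmod M$; its size is $|c_M(\gamma)|=\tau$. The elements of $\mathcal{CR}_n$ are regarded as integers. Cyclotomic system. $\mathcal{PC}_n^\ell$ is the set of sequences $(C_i)_{i\in\mathbb{N}}$ with $C_i$ a $q$-cyclotomic coset modulo $\ell^i n$ such that for all $i_1\geq i_2$ the canonical projection $\mathbb{Z}/\ell^{i_1}n\mathbb{Z}\to\mathbb{Z}/\ell^{i_2}n\mathbb{Z}$ maps $C_{i_1}$ onto $C_{i_2}$. Splitting types. Let $c_M(\delta)$ be a $q$-cyclotomic coset modulo $M$ of size $\tau'$. It is semi-splitting (with respect to $\mathbb{Z}/\ell M\mathbb{Z}:\mathbb{Z}/M\mathbb{Z}$) if $\ell\nmid q^{\tau'}-1$. If $\ell\mid q^{\tau'}-1$, it is splitting if $v_\ell(\delta)+v_\ell(q^{\tau'}-1)\geq v_\ell(M)+1$ for some (equivalently every) integer representative $\delta$ of $\delta+M\mathbb{Z}$,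 and nonsplitting (or stable) otherwise. A sequence $(C_i)_i$ is splitting / semi-splitting / nonsplitting (stable) at degree $i$ if $C_i$ is so (with $M=\ell^i n$). The sets $\mathcal{PC}_n^\ell(\gamma;m)$. Let $\gamma\in\mathcal{CR}_n$, $\tau=|c_n(\gamma)|$. Let $\varphi(\gamma)=-\gamma/n\in\mathbb{Z}_\ell$ with $\ell$-adic expansion $\sum_{k\geq0}\phi_k\ell^k$, $\phi_k\in[0,\ell-1]$; $\varphi(\gamma)_{\leq i}=\sum_{k=0}^i\phi_k\ell^k$ and $\varphi(\gamma)_{\leq-1}=0$. Put $\mathfrak{c}_\infty(\gamma)=(c_{\ell^in}(\gamma+n\cdot\varphi(\gamma)_{\leq i-1}))_{i\in\mathbb{N}}$ and $\mathcal{PC}_n^\ell(\gamma;\infty)=\{\mathfrak{c}_\infty(\gamma)\}$. Let $r=\frac{\ell-1}{\mathrm{ord}_\ell(q^\tau)}$ (so $r=\ell-1$ if $\ell\mid q^\tau-1$). For $m\in\mathbb{N}$ and $a\in[1,r]$ define $U(\gamma;m,a)=\sum_{k=0}^{m-1}\phi_k\ell^k+u\,\ell^m$, where: if $\ell\mid q^\tau-1$, $u=\sigma_a^m$ with $[0,\ell-1]\setminus\{\phi_m\}=\{\sigma_1^m<\cdots<\sigma_{\ell-1}^m\}$; if $\ell\nmid q^\tau-1$, $u\in[0,\ell-1]$ is determined by $u\equiv\phi_m+\sigma_a\pmod\ell$, where $\{\sigma_1<\cdots<\sigma_r\}\subseteq[1,\ell-1]$ is a fixed full set of representatives of $(\mathbb{Z}/\ell\mathbb{Z})^*/\langle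 q^\tau\rangle$. With $v$ as in (2), put $\mathfrak{c}_{m,a,t}(\gamma)=(c_{\ell^in}(\gamma+n(U(\gamma;m,a)+\ell^{m+1}t)))_{i\in\mathbb{N}}$ and, for $m\in\mathbb{N}$, $$\mathcal{PC}_n^\ell(\gamma;m)=\{\mathfrak{c}_{m,a,t}(\gamma)\mid a\in[1,r],\ t\in[0,\ell^{v-1}-1]\}.$$
   Formalization: In (2), case ℓ∤q^τ−1, degree i=m is semi-splitting, not splitting: semi-splitting for i≤m, splitting for m+1≤i≤m+v−1, nonsplitting for i≥m+v. The printed claim fails at i=m, e.g. q=2, ℓ=3, n=1, γ=0, m=0. *)

theory Defs
  imports
    "HOL-Number_Theory.Number_Theory"
    "HOL-Algebra.Coset"
    "HOL-Algebra.Generated_Groups"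
    "HOL-Library.Extended_Nat"
    "HOL-Library.Disjoint_Sets"
begin

section \<open>Cyclotomic cosets and the cyclotomic system\<close>

text \<open>The ring of integers modulo \<open>M\<close> is represented by the residues \<open>{0..<M}\<close>
  (the carrier of \<^const>\<open>residue_ring\<close>); the canonical projection to a divisor \<open>N\<close> of \<open>M\<close>
  is then \<open>\<lambda>x. x mod N\<close>.\<close>

definition cyc_period :: "nat \<Rightarrow> nat \<Rightarrow> int \<Rightarrow> nat" where
  "cyc_period q M \<gamma> = (LEAST t. 0 < t \<and> [\<gamma> * int q ^ t = \<gamma>] (mod int M))"

definition cyc_coset :: "nat \<Rightarrow> nat \<Rightarrow> int \<Rightarrow> int set" where
  "cyc_coset q M \<gamma> = (\<lambda>j. (\<gamma> * int q ^ j) mod int M) ` {..<cyc_period q M \<gamma>}"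

definition cyc_cosets :: "nat \<Rightarrow> nat \<Rightarrow> int set set" where
  "cyc_cosets q M = range (cyc_coset q M)"

definition coset_reps :: "nat \<Rightarrow> nat \<Rightarrow> int set \<Rightarrow> bool" where
  "coset_reps q n R \<longleftrightarrow> bij_betw (cyc_coset q n) R (cyc_cosets q n)"

definition PC :: "nat \<Rightarrow> nat \<Rightarrow> nat \<Rightarrow> (nat \<Rightarrow> int set) set" where
  "PC q l n = {C. (\<forall>i. C i \<in> cyc_cosets q (l ^ i * n)) \<and>
     (\<forall>i1 i2. i2 \<le> i1 \<longrightarrow> (\<lambda>x. x mod int (l ^ i2 * n)) ` C i1 = C i2)}"


section \<open>Splitting types\<close>

text \<open>\<^const>\<open>multiplicity\<close> is 0 at 0, whereas the valuation of 0 is infinite.\<close>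

definition val :: "nat \<Rightarrow> int \<Rightarrow> enat" where
  "val l x = (if x = 0 then \<infinity> else enat (multiplicity (int l) x))"

text \<open>In the following, \<open>C\<close> is a \<open>q\<close>-cyclotomic coset modulo \<open>M\<close>. The integers \<open>\<delta>\<close> with
  \<open>cyc_coset q M \<delta> = C\<close> are precisely the integer representatives of the elements of \<open>C\<close>.\<close>

definition semi_splitting :: "nat \<Rightarrow> nat \<Rightarrow> nat \<Rightarrow> int set \<Rightarrow> bool" where
  "semi_splitting q l M C \<longleftrightarrow> \<not> int l dvd int q ^ card C - 1"

definition splitting :: "nat \<Rightarrow> nat \<Rightarrow> nat \<Rightarrow> int set \<Rightarrow> bool" where
  "splitting q l M C \<longleftrightarrow> int l dvd int q ^ card C - 1 \<and>
     (\<exists>\<delta>. cyc_coset q M \<delta> = C \<and> val l \<delta> + val l (int q ^ card C - 1) \<ge> val l (int M) + 1)"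

definition nonsplitting :: "nat \<Rightarrow> nat \<Rightarrow> nat \<Rightarrow> int set \<Rightarrow> bool" where
  "nonsplitting q l M C \<longleftrightarrow> int l dvd int q ^ card C - 1 \<and> \<not> splitting q l M C"

definition semi_splitting_at :: "nat \<Rightarrow> nat \<Rightarrow> nat \<Rightarrow> (nat \<Rightarrow> int set) \<Rightarrow> nat \<Rightarrow> bool" where
  "semi_splitting_at q l n C i \<longleftrightarrow> semi_splitting q l (l ^ i * n) (C i)"

definition splitting_at :: "nat \<Rightarrow> nat \<Rightarrow> nat \<Rightarrow> (nat \<Rightarrow> int set) \<Rightarrow> nat \<Rightarrow> bool" where
  "splitting_at q l n C i \<longleftrightarrow> splitting q l (l ^ i * n) (C i)"

definition nonsplitting_at :: "nat \<Rightarrow> nat \<Rightarrow> nat \<Rightarrow> (nat \<Rightarrow> int set) \<Rightarrow> nat \<Rightarrow> bool" where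
  "nonsplitting_at q l n C i \<longleftrightarrow> nonsplitting q l (l ^ i * n) (C i)"


section \<open>The \<open>l\<close>-adic integers and the expansion of \<open>- \<gamma> / n\<close>\<close>

text \<open>The inverse limit of the rings of integers modulo \<open>l ^ k\<close>.\<close>

definition padic_ring :: "nat \<Rightarrow> (nat \<Rightarrow> int) ring" where
  "padic_ring l =
    \<lparr>carrier = {x. \<forall>k. x k \<in> {0..<int l ^ k} \<and> x (Suc k) mod int l ^ k = x k},
     monoid.mult = (\<lambda>x y k. (x k * y k) mod int l ^ k),
     one = (\<lambda>k. 1 mod int l ^ k),
     zero = (\<lambda>k. 0),
     add = (\<lambda>x y k. (x k + y k) mod int l ^ k)\<rparr>"

definition padic_of_int :: "nat \<Rightarrow> int \<Rightarrow> nat \<Rightarrow> int" where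
  "padic_of_int l a = (\<lambda>k. a mod int l ^ k)"

definition padic_digit :: "nat \<Rightarrow> (nat \<Rightarrow> int) \<Rightarrow> nat \<Rightarrow> int" where
  "padic_digit l x k = x (Suc k) div int l ^ k"

lemma padic_carrierD:
  assumes "x \<in> carrier (padic_ring l)"
  shows "x k \<in> {0..<int l ^ k}" "x (Suc k) mod int l ^ k = x k"
  using assms by (auto simp: padic_ring_def)

lemma int_div_less_aux:
  assumes "(x::int) < b * c" "c > 0"
  shows "x div c < b"
proof (rule ccontr)
  assume "\<not> x div c < b"
  then have "b * c \<le> x div c * c" using assms(2) by (simp add: mult_right_mono)
  also have "\<dots> \<le> x" using assms(2) div_mult_mod_eq[of x c] pos_mod_sign[of c x] by linarith
  finally show False using assms(1) by simp
qed

lemma padic_digit_range: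
  assumes "x \<in> carrier (padic_ring l)" "l > 0"
  shows "padic_digit l x k \<in> {0..int l - 1}"
proof -
  have "0 \<le> x (Suc k)" "x (Suc k) < int l * int l ^ k"
    using padic_carrierD(1)[OF assms(1), of "Suc k"] by simp_all
  moreover have "int l ^ k > 0" using assms(2) by simp
  ultimately have "0 \<le> x (Suc k) div int l ^ k" "x (Suc k) div int l ^ k < int l"
    by (simp_all add: pos_imp_zdiv_nonneg_iff int_div_less_aux)
  then show ?thesis by (simp add: padic_digit_def)
qed

lemma padic_digit_expansion:
  assumes "x \<in> carrier (padic_ring l)"
  shows "(\<Sum>k<i. padic_digit l x k * int l ^ k) = x i"
proof (induction i)
  case 0
  have "x 0 \<in> {0..<int l ^ 0}" using assms by (rule padic_carrierD)
  then show ?case by simp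
next
  case (Suc i)
  have "x (Suc i) mod int l ^ i = x i" using assms by (rule padic_carrierD)
  then show ?case using Suc div_mult_mod_eq[of "x (Suc i)" "int l ^ i"]
    by (simp add: padic_digit_def)
qed

definition phi :: "nat \<Rightarrow> nat \<Rightarrow> int \<Rightarrow> nat \<Rightarrow> int" where
  "phi l n \<gamma> = padic_of_int l (- \<gamma>) \<otimes>\<^bsub>padic_ring l\<^esub> inv\<^bsub>padic_ring l\<^esub> (padic_of_int l (int n))"

lemma phi_spec:
  assumes "coprime l n" "l > 0"
  shows "phi l n \<gamma> \<in> carrier (padic_ring l)"
    and "padic_of_int l (int n) \<otimes>\<^bsub>padic_ring l\<^esub> phi l n \<gamma> = padic_of_int l (- \<gamma>)"
proof -
  let ?R = "padic_ring l"
  define w where "w = (\<lambda>k. modular_inverse (int l ^ k) (int n))"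
  have pos: "int l ^ k > 0" for k using assms(2) by simp
  have cop: "coprime (int n) (int l ^ k)" for k
    using assms(1) by (simp add: coprime_commute)
  have w1: "[int n * w k = 1] (mod int l ^ k)" for k
    unfolding w_def by (rule cong_modular_inverse1) (rule cop)
  have w0: "w k \<in> {0..<int l ^ k}" for k
    unfolding w_def using pos by (simp add: modular_inverse_int_nonneg modular_inverse_int_less)
  have uniq: "x = y" if "[int n * x = 1] (mod int l ^ k)" "[int n * y = 1] (mod int l ^ k)"
    "x \<in> {0..<int l ^ k}" "y \<in> {0..<int l ^ k}" for x y k
  proof -
    have "[int n * x = int n * y] (mod int l ^ k)" using that(1,2) cong_sym cong_trans by blast
    then have "[x = y] (mod int l ^ k)" using cong_mult_lcancel[OF cop] by blast
    then show ?thesis using that(3,4) by (simp add: cong_def)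
  qed
  have wc: "w (Suc k) mod int l ^ k = w k" for k
  proof (rule uniq[of _ k])
    have "[int n * w (Suc k) = 1] (mod int l ^ k)"
      using w1[of "Suc k"] by (rule cong_dvd_modulus) simp
    then show "[int n * (w (Suc k) mod int l ^ k) = 1] (mod int l ^ k)"
      by (simp add: cong_def mod_mult_right_eq)
  qed (use w1 w0 pos in auto)
  have wcar: "w \<in> carrier ?R" unfolding padic_ring_def using w0 wc by simp
  have inv: "inv\<^bsub>?R\<^esub> (padic_of_int l (int n)) = w"
    unfolding m_inv_def
  proof (rule the_equality)
    show "w \<in> carrier ?R \<and> padic_of_int l (int n) \<otimes>\<^bsub>?R\<^esub> w = \<one>\<^bsub>?R\<^esub> \<and>
        w \<otimes>\<^bsub>?R\<^esub> padic_of_int l (int n) = \<one>\<^bsub>?R\<^esub>"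
      using wcar w1 by (auto simp: padic_ring_def padic_of_int_def cong_def mult.commute mod_simps)
  next
    fix y assume y: "y \<in> carrier ?R \<and> padic_of_int l (int n) \<otimes>\<^bsub>?R\<^esub> y = \<one>\<^bsub>?R\<^esub> \<and>
        y \<otimes>\<^bsub>?R\<^esub> padic_of_int l (int n) = \<one>\<^bsub>?R\<^esub>"
    show "y = w"
    proof
      fix k
      have "[int n * y k = 1] (mod int l ^ k)"
        using y by (auto simp: padic_ring_def padic_of_int_def cong_def mod_simps dest: fun_cong[of _ _ k])
      moreover have "y k \<in> {0..<int l ^ k}" using y unfolding padic_ring_def by simp
      ultimately show "y k = w k" using uniq w1 w0 by blast
    qed
  qed
  have ph: "phi l n \<gamma> k = (- \<gamma> * w k) mod int l ^ k" for k
    unfolding phi_def inv by (simp add: padic_ring_def padic_of_int_def mod_simps)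
  have "phi l n \<gamma> (Suc k) mod int l ^ k = phi l n \<gamma> k" for k
  proof -
    have "phi l n \<gamma> (Suc k) mod int l ^ k = (- \<gamma> * w (Suc k)) mod int l ^ k"
      unfolding ph by (rule mod_mod_cancel) simp
    also have "\<dots> = (- \<gamma> * (w (Suc k) mod int l ^ k)) mod int l ^ k" by (simp only: mod_mult_right_eq)
    finally show ?thesis by (simp only: wc ph)
  qed
  then show "phi l n \<gamma> \<in> carrier ?R" using pos unfolding padic_ring_def by (simp add: ph)
  show "padic_of_int l (int n) \<otimes>\<^bsub>?R\<^esub> phi l n \<gamma> = padic_of_int l (- \<gamma>)"
  proof
    fix k
    have "[int n * (- \<gamma> * w k) = - \<gamma>] (mod int l ^ k)"
      using cong_scalar_left[OF w1[of k], of "- \<gamma>"] by (simp add: ac_simps)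
    then show "(padic_of_int l (int n) \<otimes>\<^bsub>?R\<^esub> phi l n \<gamma>) k = padic_of_int l (- \<gamma>) k"
      by (simp add: padic_ring_def padic_of_int_def ph cong_def mod_simps)
  qed
qed

definition phi_digit :: "nat \<Rightarrow> nat \<Rightarrow> int \<Rightarrow> nat \<Rightarrow> int" where
  "phi_digit l n \<gamma> k = padic_digit l (phi l n \<gamma>) k"

text \<open>Truncation to the first \<open>i\<close> digits, that is, to the digits of index at most \<open>i - 1\<close>.\<close>

definition phi_trunc :: "nat \<Rightarrow> nat \<Rightarrow> int \<Rightarrow> nat \<Rightarrow> int" where
  "phi_trunc l n \<gamma> i = (\<Sum>k<i. phi_digit l n \<gamma> k * int l ^ k)"


section \<open>The components of the decomposition\<close>

definition csize :: "nat \<Rightarrow> nat \<Rightarrow> int \<Rightarrow> nat" where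
  "csize q n \<gamma> = card (cyc_coset q n \<gamma>)"

definition num_reps :: "nat \<Rightarrow> nat \<Rightarrow> nat \<Rightarrow> int \<Rightarrow> nat" where
  "num_reps q l n \<gamma> = (l - 1) div ord l (q ^ csize q n \<gamma>)"

definition vexp :: "nat \<Rightarrow> nat \<Rightarrow> nat \<Rightarrow> int \<Rightarrow> nat" where
  "vexp q l n \<gamma> = (let \<tau> = csize q n \<gamma> in
     if int l dvd int q ^ \<tau> - 1 then multiplicity (int l) (int q ^ \<tau> - 1)
     else multiplicity (int l) (int q ^ (\<tau> * ord l (q ^ \<tau>)) - 1))"

text \<open>\<open>unit_quot_reps l g S\<close>: the set \<open>S\<close> of integers between 1 and \<open>l - 1\<close> is a full set of
  representatives of the quotient of the unit group modulo \<open>l\<close> by the subgroup generated by the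
  class of \<open>g\<close>.\<close>

definition unit_quot_reps :: "nat \<Rightarrow> int \<Rightarrow> int set \<Rightarrow> bool" where
  "unit_quot_reps l g S \<longleftrightarrow> S \<subseteq> {1..int l - 1} \<and>
     (let G = units_of (residue_ring (int l)); H = generate G {g mod int l}
      in bij_betw (\<lambda>s. H #>\<^bsub>G\<^esub> s) S (carrier (G Mod H)))"

text \<open>The leading digit \<open>u\<close>. The set \<open>S\<close> is the fixed set of representatives \<open>\<sigma>\<close>, relevant
  only if \<open>l\<close> does not divide \<open>q ^ \<tau> - 1\<close>. The index \<open>a\<close> counts from 1, list positions
  from 0.\<close>

definition lead_digit :: "nat \<Rightarrow> nat \<Rightarrow> nat \<Rightarrow> int set \<Rightarrow> int \<Rightarrow> nat \<Rightarrow> nat \<Rightarrow> int" where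
  "lead_digit q l n S \<gamma> m a =
    (if int l dvd int q ^ csize q n \<gamma> - 1
     then sorted_list_of_set ({0..int l - 1} - {phi_digit l n \<gamma> m}) ! (a - 1)
     else (phi_digit l n \<gamma> m + sorted_list_of_set S ! (a - 1)) mod int l)"

definition Unum :: "nat \<Rightarrow> nat \<Rightarrow> nat \<Rightarrow> int set \<Rightarrow> int \<Rightarrow> nat \<Rightarrow> nat \<Rightarrow> int" where
  "Unum q l n S \<gamma> m a =
     (\<Sum>k<m. phi_digit l n \<gamma> k * int l ^ k) + lead_digit q l n S \<gamma> m a * int l ^ m"

definition seq_inf :: "nat \<Rightarrow> nat \<Rightarrow> nat \<Rightarrow> int \<Rightarrow> nat \<Rightarrow> int set" where
  "seq_inf q l n \<gamma> = (\<lambda>i. cyc_coset q (l ^ i * n) (\<gamma> + int n * phi_trunc l n \<gamma> i))"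

definition seq_fin ::
    "nat \<Rightarrow> nat \<Rightarrow> nat \<Rightarrow> int set \<Rightarrow> int \<Rightarrow> nat \<Rightarrow> nat \<Rightarrow> nat \<Rightarrow> nat \<Rightarrow> int set" where
  "seq_fin q l n S \<gamma> m a t = (\<lambda>i. cyc_coset q (l ^ i * n)
     (\<gamma> + int n * (Unum q l n S \<gamma> m a + int l ^ (m + 1) * int t)))"

definition PC_part :: "nat \<Rightarrow> nat \<Rightarrow> nat \<Rightarrow> int set \<Rightarrow> int \<Rightarrow> enat \<Rightarrow> (nat \<Rightarrow> int set) set" where
  "PC_part q l n S \<gamma> m = (case m of
     enat m' \<Rightarrow> {seq_fin q l n S \<gamma> m' a t | a t.
       a \<in> {1..num_reps q l n \<gamma>} \<and> t \<in> {0..l ^ (vexp q l n \<gamma> - 1) - 1}}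
   | \<infinity> \<Rightarrow> {seq_inf q l n \<gamma>})"

text \<open>Pitfall, shown here for \<open>m = 0\<close>: if \<open>l\<close> does not divide \<open>q ^ \<tau> - 1\<close>, a sequence in
  \<open>PC_part q l n S \<gamma> (enat m)\<close> is semi-splitting at degree \<open>m\<close> itself; it starts to be
  splitting (or nonsplitting) only at degree \<open>m + 1\<close>. The same holds for every \<open>m\<close>, since
  \<open>l ^ m\<close> divides \<open>\<gamma> + n U\<close> and so the coset at degree \<open>m\<close> still has size \<open>\<tau>\<close>.\<close>

lemma semi_splitting_at_0:
  assumes "\<not> int l dvd int q ^ csize q n \<gamma> - 1" "C \<in> PC_part q l n S \<gamma> (enat m)"
  shows "semi_splitting_at q l n C 0" "\<not> splitting_at q l n C 0"
proof -
  obtain a t where C: "C = seq_fin q l n S \<gamma> m a t"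
    using assms(2) by (auto simp: PC_part_def)
  have shift: "cyc_coset q n (\<gamma> + int n * z) = cyc_coset q n \<gamma>" for z
  proof -
    have "((\<gamma> + int n * z) * w) mod int n = (\<gamma> * w) mod int n" for w
      by (metis mod_mult_left_eq mod_mult_self2)
    then show ?thesis by (simp add: cyc_coset_def cyc_period_def cong_def)
  qed
  have "C 0 = cyc_coset q n \<gamma>" unfolding C seq_fin_def by (simp add: shift)
  then show "semi_splitting_at q l n C 0" "\<not> splitting_at q l n C 0"
    using assms(1) by (simp_all add: semi_splitting_at_def semi_splitting_def
      splitting_at_def splitting_def csize_def)
qed

end

theory Submission
  imports Defs
begin

text \<open>A sequence in the cyclotomic system is the \<open>q\<close>-orbit of a compatible family \<open>x i\<close>, which we
  may start at a representative \<open>\<gamma>\<close>. Either \<open>l ^ i\<close> divides \<open>x i\<close> for all \<open>i\<close>, and the family is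
  \<open>\<gamma> + n * phi_trunc l n \<gamma> i\<close>, or the family has a finite \<open>l\<close>-adic valuation \<open>m\<close>, which is an
  invariant of the orbit. In the second case let \<open>D\<close> be the order of \<open>q ^ \<tau>\<close> modulo \<open>l\<close> and \<open>w\<close> the
  valuation of \<open>q ^ (\<tau> * D) - 1\<close>. The stabiliser of the class of \<open>\<gamma>\<close> is generated by \<open>q ^ \<tau>\<close>, whose
  powers move the leading digit within a coset of \<open>\<langle>q ^ \<tau>\<rangle>\<close>, while the powers of \<open>q ^ (\<tau> * D)\<close> fill
  all principal units \<open>1 + l ^ w * \<int>\<close>: only the leading digit modulo \<open>\<langle>q ^ \<tau>\<rangle>\<close> and the next
  \<open>w - 1\<close> digits remain. Since \<open>l\<close> is odd, lifting the exponent gives the coset size at degree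
  \<open>i\<close> as \<open>\<tau>\<close> for \<open>i \<le> m\<close> and \<open>\<tau> * D * l ^ (i - m - w)\<close> (truncated subtraction) for \<open>i > m\<close>, from
  which the splitting types can be read off. If \<open>l\<close> divides \<open>q ^ \<tau> - 1\<close> then \<open>D = 1\<close>, so both
  cases of the theorem are treated uniformly.\<close>

section \<open>Cyclotomic cosets and compatible sequences\<close>

lemma coprime_cong_power_one_exists:
  assumes "coprime q M" "0 < M"
  shows "\<exists>t>0. [int q ^ t = 1] (mod int M)"
proof (intro exI conjI)
  show "0 < totient M" using assms by simp
  have "[q ^ totient M = 1] (mod M)" using assms(1) by (rule euler_theorem)
  then show "[int q ^ totient M = 1] (mod int M)"
    by (metis cong_int_iff of_nat_1 of_nat_power)
qed

lemma cyc_period_props: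
  assumes "coprime q M" "0 < M"
  shows "0 < cyc_period q M \<gamma>" "[\<gamma> * int q ^ cyc_period q M \<gamma> = \<gamma>] (mod int M)"
proof -
  obtain t where "0 < t" "[int q ^ t = 1] (mod int M)"
    using coprime_cong_power_one_exists[OF assms] by blast
  then have "0 < t \<and> [\<gamma> * int q ^ t = \<gamma>] (mod int M)"
    using cong_scalar_left[of "int q ^ t" 1 "int M" \<gamma>] by simp
  from LeastI[of "\<lambda>t. 0 < t \<and> [\<gamma> * int q ^ t = \<gamma>] (mod int M)", OF this]
  show "0 < cyc_period q M \<gamma>" "[\<gamma> * int q ^ cyc_period q M \<gamma> = \<gamma>] (mod int M)"
    unfolding cyc_period_def by blast+
qed

lemma cong_cyc_period_mult:
  assumes "coprime q M" "0 < M"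
  shows "[\<gamma> * int q ^ (cyc_period q M \<gamma> * k) = \<gamma>] (mod int M)"
proof (induction k)
  case (Suc k)
  have "[\<gamma> * int q ^ (cyc_period q M \<gamma> * k) * int q ^ cyc_period q M \<gamma>
      = \<gamma> * int q ^ cyc_period q M \<gamma>] (mod int M)"
    using Suc by (rule cong_scalar_right)
  also have "[\<gamma> * int q ^ cyc_period q M \<gamma> = \<gamma>] (mod int M)"
    by (rule cyc_period_props(2)[OF assms])
  finally show ?case by (simp add: power_add algebra_simps)
qed simp

lemma cong_mult_q_power_cancel:
  assumes "coprime q M"
  shows "[x * int q ^ j = y * int q ^ j] (mod int M) \<longleftrightarrow> [x = y] (mod int M)"
  by (rule cong_mult_rcancel) (use assms in \<open>simp add: coprime_commute\<close>)

text \<open>Division with remainder by the period leaves a smaller exponent with the same property,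
  which minimality forces to be 0.\<close>

lemma cong_iff_cyc_period_dvd:
  assumes "coprime q M" "0 < M"
  shows "[\<gamma> * int q ^ t = \<gamma>] (mod int M) \<longleftrightarrow> cyc_period q M \<gamma> dvd t"
proof
  define d where "d = cyc_period q M \<gamma>"
  assume *: "[\<gamma> * int q ^ t = \<gamma>] (mod int M)"
  have "[\<gamma> * int q ^ (d * (t div d)) * int q ^ (t mod d) = \<gamma> * int q ^ (t mod d)] (mod int M)"
    unfolding d_def by (intro cong_scalar_right cong_cyc_period_mult assms)
  then have "[\<gamma> * int q ^ t = \<gamma> * int q ^ (t mod d)] (mod int M)"
    by (simp add: mult.assoc flip: power_add)
  with * have "[\<gamma> * int q ^ (t mod d) = \<gamma>] (mod int M)" by (simp add: cong_def)
  moreover have "t mod d < d"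
    using cyc_period_props(1)[OF assms] by (simp add: d_def)
  ultimately have "t mod d = 0"
    using not_less_Least[of "t mod d" "\<lambda>t. 0 < t \<and> [\<gamma> * int q ^ t = \<gamma>] (mod int M)"]
    unfolding d_def cyc_period_def by auto
  then show "cyc_period q M \<gamma> dvd t" by (simp add: d_def mod_eq_0_iff_dvd)
next
  assume "cyc_period q M \<gamma> dvd t"
  then show "[\<gamma> * int q ^ t = \<gamma>] (mod int M)"
    using cong_cyc_period_mult[OF assms] by (auto elim!: dvdE)
qed

text \<open>Later periods are found by solving the congruence for all \<open>t\<close> at once,
  since numbers with the same multiples are equal.\<close>

lemma cyc_period_eqI:
  assumes "coprime q M" "0 < M"
    and "\<And>t. [\<gamma> * int q ^ t = \<gamma>] (mod int M) \<longleftrightarrow> d dvd t"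
  shows "cyc_period q M \<gamma> = d"
proof -
  have "cyc_period q M \<gamma> dvd t \<longleftrightarrow> d dvd t" for t
    using assms(3) cong_iff_cyc_period_dvd[OF assms(1,2)] by simp
  from this[of d] this[of "cyc_period q M \<gamma>"] show ?thesis by (simp add: dvd_antisym)
qed

text \<open>Exponents count only modulo the period. Dropping the bound on them lets membership and
  equality of cosets be decided without knowing the period.\<close>

lemma cyc_coset_eq_range:
  assumes "coprime q M" "0 < M"
  shows "cyc_coset q M \<gamma> = range (\<lambda>j. (\<gamma> * int q ^ j) mod int M)"
proof
  show "range (\<lambda>j. (\<gamma> * int q ^ j) mod int M) \<subseteq> cyc_coset q M \<gamma>"
  proof clarify
    fix j
    define d where "d = cyc_period q M \<gamma>"
    have "[\<gamma> * int q ^ (d * (j div d)) * int q ^ (j mod d) = \<gamma> * int q ^ (j mod d)] (mod int M)"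
      unfolding d_def by (intro cong_scalar_right cong_cyc_period_mult assms)
    then have "(\<gamma> * int q ^ j) mod int M = (\<gamma> * int q ^ (j mod d)) mod int M"
      by (simp add: mult.assoc cong_def flip: power_add)
    moreover have "j mod d < d"
      using cyc_period_props(1)[OF assms] by (simp add: d_def)
    ultimately show "(\<gamma> * int q ^ j) mod int M \<in> cyc_coset q M \<gamma>"
      unfolding cyc_coset_def d_def by blast
  qed
qed (auto simp: cyc_coset_def)

lemma card_cyc_coset:
  assumes "coprime q M" "0 < M"
  shows "card (cyc_coset q M \<gamma>) = cyc_period q M \<gamma>"
proof -
  have *: "i = j" if "i \<le> j" "j < cyc_period q M \<gamma>"
    "(\<gamma> * int q ^ i) mod int M = (\<gamma> * int q ^ j) mod int M" for i j
  proof -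
    have "[(\<gamma> * int q ^ (j - i)) * int q ^ i = \<gamma> * int q ^ i] (mod int M)"
      using that by (simp add: cong_def mult.assoc flip: power_add)
    then have "cyc_period q M \<gamma> dvd j - i"
      by (simp add: cong_mult_q_power_cancel[OF assms(1)] cong_iff_cyc_period_dvd[OF assms])
    then show ?thesis using that by (auto dest: dvd_imp_le)
  qed
  have "inj_on (\<lambda>j. (\<gamma> * int q ^ j) mod int M) {..<cyc_period q M \<gamma>}"
    by (rule linorder_inj_onI') (metis * lessThan_iff less_imp_le less_irrefl)
  then show ?thesis by (simp add: cyc_coset_def card_image)
qed

lemma mod_mem_cyc_coset_iff:
  assumes "coprime q M" "0 < M"
  shows "x mod int M \<in> cyc_coset q M \<gamma> \<longleftrightarrow> (\<exists>j. [x = \<gamma> * int q ^ j] (mod int M))"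
  by (auto simp: cyc_coset_eq_range[OF assms] cong_def)

lemma cyc_coset_eqI:
  assumes "coprime q M" "0 < M" "[x = \<gamma> * int q ^ j] (mod int M)"
  shows "cyc_coset q M x = cyc_coset q M \<gamma>"
proof -
  obtain t where t: "t > 0" "[int q ^ t = 1] (mod int M)"
    using coprime_cong_power_one_exists[OF assms(1,2)] by blast
  have sub: "cyc_coset q M x \<subseteq> cyc_coset q M y" if "[x = y * int q ^ j] (mod int M)" for x y j
  proof -
    have "(x * int q ^ i) mod int M = (y * int q ^ (j + i)) mod int M" for i
      using cong_scalar_right[OF that, of "int q ^ i"] by (simp add: cong_def power_add algebra_simps)
    then show ?thesis by (auto simp: cyc_coset_eq_range[OF assms(1,2)])
  qed
  \<comment> \<open>As \<open>q ^ t\<close> is 1, the power \<open>q ^ (t * j - j)\<close> inverts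
    \<open>q ^ j\<close>; \<open>t > 0\<close> keeps the subtraction from being truncated.\<close>
  have "j + (t * j - j) = t * j" using t(1) by simp
  then have "[x * int q ^ (t * j - j) = \<gamma> * int q ^ (t * j)] (mod int M)"
    using cong_scalar_right[OF assms(3), of "int q ^ (t * j - j)"]
    by (simp add: mult.assoc flip: power_add)
  also have "[\<gamma> * int q ^ (t * j) = \<gamma>] (mod int M)"
    using cong_scalar_left[OF cong_pow[OF t(2), of j], of \<gamma>] by (simp add: power_mult)
  finally have "[\<gamma> = x * int q ^ (t * j - j)] (mod int M)" by (rule cong_sym)
  then show ?thesis using sub assms(3) by blast
qed

lemma cyc_coset_eq_iff:
  assumes "coprime q M" "0 < M"
  shows "cyc_coset q M x = cyc_coset q M \<gamma> \<longleftrightarrow> (\<exists>j. [x = \<gamma> * int q ^ j] (mod int M))"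
proof
  assume "cyc_coset q M x = cyc_coset q M \<gamma>"
  moreover have "x mod int M \<in> cyc_coset q M x"
    unfolding mod_mem_cyc_coset_iff[OF assms] by (rule exI[of _ 0]) simp
  ultimately show "\<exists>j. [x = \<gamma> * int q ^ j] (mod int M)"
    by (simp add: mod_mem_cyc_coset_iff[OF assms])
qed (use cyc_coset_eqI[OF assms] in blast)

lemma cyc_coset_cong:
  "[x = y] (mod int M) \<Longrightarrow> coprime q M \<Longrightarrow> 0 < M \<Longrightarrow> cyc_coset q M x = cyc_coset q M y"
  using cyc_coset_eqI[of q M x y 0] by simp

lemma cyc_coset_of_mem:
  assumes "coprime q M" "0 < M" "C \<in> cyc_cosets q M" "x \<in> C"
  shows "C = cyc_coset q M x"
proof -
  obtain \<gamma> where \<gamma>: "C = cyc_coset q M \<gamma>" using assms(3) by (auto simp: cyc_cosets_def)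
  then obtain j where "x = (\<gamma> * int q ^ j) mod int M"
    using assms(4) by (auto simp: cyc_coset_def)
  then have "[x = \<gamma> * int q ^ j] (mod int M)" by simp
  then show ?thesis using cyc_coset_eqI[OF assms(1,2)] \<gamma> by blast
qed

lemma image_mod_cyc_coset:
  assumes "coprime q M" "0 < M" "N dvd M"
  shows "(\<lambda>x. x mod int N) ` cyc_coset q M \<gamma> = cyc_coset q N \<gamma>"
proof -
  have "coprime q N" "0 < N" using assms
    by (auto intro: coprime_imp_coprime dvd_trans dvd_pos_nat)
  then show ?thesis using assms(3)
    by (simp add: cyc_coset_eq_range assms(1,2) image_image mod_mod_cancel)
qed

section \<open>Sequences in the cyclotomic system\<close>

lemma PC_projection:
  "C \<in> PC q l n \<Longrightarrow> j \<le> i \<Longrightarrow> C j = (\<lambda>x. x mod int (l ^ j * n)) ` C i"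
  unfolding PC_def by blast

text \<open>High degrees determine low ones by projection, so agreement need only be checked from
  some degree on.\<close>

lemma PC_eqI:
  assumes "C \<in> PC q l n" "D \<in> PC q l n" "\<And>i. k \<le> i \<Longrightarrow> C i = D i"
  shows "C = D"
proof
  fix i
  have "C i = (\<lambda>x. x mod int (l ^ i * n)) ` C (max i k)"
    by (rule PC_projection[OF assms(1)]) simp
  also have "\<dots> = (\<lambda>x. x mod int (l ^ i * n)) ` D (max i k)"
    using assms(3)[of "max i k"] by simp
  also have "\<dots> = D i" by (rule PC_projection[OF assms(2), symmetric]) simp
  finally show "C i = D i" .
qed

lemma compatible_cong:
  assumes "\<And>i. [x (Suc i) = x i] (mod int (l ^ i * n))" "j \<le> i"
  shows "[x i = x j] (mod int (l ^ j * n))"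
  using assms(2)
proof (induction i rule: dec_induct)
  case (step i)
  have "[x (Suc i) = x i] (mod int (l ^ j * n))"
    using assms(1)[of i] by (rule cong_dvd_modulus) (use step(1) in \<open>simp add: le_imp_power_dvd\<close>)
  then show ?case using step.IH by (rule cong_trans)
qed simp

lemma PC_memI:
  assumes "coprime q l" "coprime q n" "0 < l" "0 < n"
    and "\<And>i. [x (Suc i) = x i] (mod int (l ^ i * n))"
  shows "(\<lambda>i. cyc_coset q (l ^ i * n) (x i)) \<in> PC q l n"
proof -
  have "(\<lambda>y. y mod int (l ^ j * n)) ` cyc_coset q (l ^ i * n) (x i) = cyc_coset q (l ^ j * n) (x j)"
    if "j \<le> i" for i j
  proof -
    have "(\<lambda>y. y mod int (l ^ j * n)) ` cyc_coset q (l ^ i * n) (x i) = cyc_coset q (l ^ j * n) (x i)"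
      by (rule image_mod_cyc_coset) (use assms that in \<open>simp_all add: le_imp_power_dvd\<close>)
    also have "\<dots> = cyc_coset q (l ^ j * n) (x j)"
      by (rule cyc_coset_cong[OF compatible_cong[OF assms(5) that]]) (use assms in auto)
    finally show ?thesis .
  qed
  then show ?thesis unfolding PC_def cyc_cosets_def by blast
qed

text \<open>Projections are onto, so each element of \<open>C i\<close> lifts to the next degree;
  dependent choice joins the lifts into one family.\<close>

lemma PC_compatible_choice:
  assumes "C \<in> PC q l n" "c \<in> C 0"
  obtains x where "x 0 = c" "\<And>i. x i \<in> C i" "\<And>i. [x (Suc i) = x i] (mod int (l ^ i * n))"
proof -
  \<comment> \<open>The conjunct for \<open>i = 0\<close> pins the start of the family to
    \<open>c\<close>.\<close>
  have "\<exists>x. \<forall>i. (x i \<in> C i \<and> (i = 0 \<longrightarrow> x i = c)) \<and> x (Suc i) mod int (l ^ i * n) = x i"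
  proof (rule dependent_nat_choice)
    fix y i assume "y \<in> C i \<and> (i = 0 \<longrightarrow> y = c)"
    moreover have "C i = (\<lambda>x. x mod int (l ^ i * n)) ` C (Suc i)"
      by (rule PC_projection[OF assms(1)]) simp
    ultimately show "\<exists>z. (z \<in> C (Suc i) \<and> (Suc i = 0 \<longrightarrow> z = c)) \<and> z mod int (l ^ i * n) = y"
      by auto
  qed (use assms in auto)
  then obtain x where "\<forall>i. (x i \<in> C i \<and> (i = 0 \<longrightarrow> x i = c)) \<and> x (Suc i) mod int (l ^ i * n) = x i"
    by blast
  then have x: "x 0 = c" "\<And>i. x i \<in> C i" "\<And>i. x (Suc i) mod int (l ^ i * n) = x i"
    by blast+
  have "[x (Suc i) = x (Suc i) mod int (l ^ i * n)] (mod int (l ^ i * n))" for i by simp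
  then show ?thesis unfolding x(3) using that x(1,2) by blast
qed

section \<open>Powers of an integer congruent to 1 modulo an odd prime\<close>

lemma power_one_plus_cong_square: "[(1 + d) ^ s = 1 + int s * d] (mod d\<^sup>2)"
proof (induction s)
  case (Suc s)
  have "[(1 + d) ^ s * (1 + d) = (1 + int s * d) * (1 + d)] (mod d\<^sup>2)"
    using Suc by (rule cong_scalar_right)
  also have "(1 + int s * d) * (1 + d) = (1 + int (Suc s) * d) + d\<^sup>2 * int s"
    by (simp add: algebra_simps power2_eq_square)
  also have "[\<dots> = 1 + int (Suc s) * d] (mod d\<^sup>2)" by (simp add: cong_def)
  finally show ?case by (simp add: mult.commute)
qed simp

text \<open>The quadratic term is kept because for \<open>s = l\<close> its coefficient
  \<open>l choose 2\<close> supplies a further factor \<open>l\<close>.\<close>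

lemma power_one_plus_cong_cube:
  "[(1 + d) ^ s = 1 + int s * d + int (s choose 2) * d\<^sup>2] (mod d ^ 3)"
proof (induction s)
  case (Suc s)
  have "[(1 + d) ^ s * (1 + d) = (1 + int s * d + int (s choose 2) * d\<^sup>2) * (1 + d)] (mod d ^ 3)"
    using Suc by (rule cong_scalar_right)
  also have "Suc s choose 2 = s + (s choose 2)"
    by (simp add: numeral_2_eq_2)
  then have "(1 + int s * d + int (s choose 2) * d\<^sup>2) * (1 + d)
      = (1 + int (Suc s) * d + int (Suc s choose 2) * d\<^sup>2) + d ^ 3 * int (s choose 2)"
    by (simp add: algebra_simps power2_eq_square power3_eq_cube)
  also have "[\<dots> = 1 + int (Suc s) * d + int (Suc s choose 2) * d\<^sup>2] (mod d ^ 3)" by (simp add: cong_def)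
  finally show ?case by (simp add: mult.commute)
qed (simp add: numeral_2_eq_2)

text \<open>The two divisibility assumptions say that \<open>g - 1\<close> has valuation exactly
  \<open>w\<close>; later \<open>g\<close> is \<open>q ^ (tau y * D y)\<close>.\<close>

locale odd_prime_unit =
  fixes l :: nat and g :: int and w :: nat
  assumes prime_l: "prime l" and odd_l: "odd l" and w_pos: "0 < w"
    and dvd_w: "int l ^ w dvd g - 1" and not_dvd_w: "\<not> int l ^ Suc w dvd g - 1"
begin

lemma l_pos: "0 < l" using prime_l by (rule prime_gt_0_nat)

text \<open>Each \<open>l\<close>-th power raises the valuation by exactly one. If \<open>d\<close>
  has valuation \<open>k \<ge> 1\<close>, only \<open>l * d\<close> survives modulo
  \<open>l ^ (k + 2)\<close>: the quadratic term and the cubic error have valuation at least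
  \<open>2 * k + 1\<close> and \<open>3 * k\<close>.\<close>

lemma power_l_power:
  assumes "w \<le> k"
  shows "\<exists>c. g ^ l ^ (k - w) = 1 + int l ^ k * c \<and> \<not> int l dvd c"
  using assms
proof (induction k rule: dec_induct)
  case base
  obtain c where c: "g - 1 = int l ^ w * c" using dvd_w by (elim dvdE)
  moreover have "\<not> int l dvd c"
    using not_dvd_w unfolding c by (simp add: mult.commute[of "int l"] l_pos)
  ultimately show ?case by (intro exI[of _ c]) (simp add: algebra_simps)
next
  case (step k)
  then obtain c where c: "g ^ l ^ (k - w) = 1 + int l ^ k * c" "\<not> int l dvd c" by blast
  define d where "d = int l ^ k * c"
  have k: "0 < k" using step w_pos by simp
  \<comment> \<open>Oddness of \<open>l\<close> enters here; the divisibility fails for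
    \<open>l = 2\<close>.\<close>
  have "l dvd (l choose 2)"
    using prime_l odd_l prime_gt_1_nat[OF prime_l]
    by (intro dvd_choose_prime) (auto simp: order_less_le)
  then obtain b where b: "int (l choose 2) = int l * b"
    by (metis dvdE of_nat_mult)
  have "d ^ 3 = (int l ^ Suc (Suc k)) * (int l ^ (2 * k - 2) * c ^ 3)"
  proof -
    have "3 * k = Suc (Suc k) + (2 * k - 2)" using k by simp
    then have "int l ^ (3 * k) = int l ^ Suc (Suc k) * int l ^ (2 * k - 2)"
      by (metis power_add)
    moreover have "d ^ 3 = int l ^ (3 * k) * c ^ 3"
      by (simp add: d_def power_mult_distrib mult.commute flip: power_mult)
    ultimately show ?thesis by (simp add: mult.assoc)
  qed
  then have "int l ^ Suc (Suc k) dvd d ^ 3" by (metis dvd_triv_left)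
  with power_one_plus_cong_cube[of d l]
  have "[(1 + d) ^ l = 1 + int l * d + int (l choose 2) * d\<^sup>2] (mod int l ^ Suc (Suc k))"
    by (rule cong_dvd_modulus)
  moreover have "int (l choose 2) * d\<^sup>2 = int l ^ Suc (Suc k) * (int l ^ (k - 1) * b * c\<^sup>2)"
  proof -
    have "int l * int l ^ (2 * k) = int l ^ Suc (Suc k) * int l ^ (k - 1)"
      using k by (simp add: mult_2 flip: power_Suc power_add)
    moreover have "d\<^sup>2 = int l ^ (2 * k) * c\<^sup>2"
      by (simp add: d_def power_mult_distrib mult.commute flip: power_mult)
    ultimately show ?thesis unfolding b by (metis (no_types, lifting) mult.assoc mult.commute)
  qed
  ultimately have "[(1 + d) ^ l = 1 + int l * d] (mod int l ^ Suc (Suc k))"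
    by (simp add: cong_def)
  then obtain e where e: "(1 + d) ^ l = 1 + int l * d + int l ^ Suc (Suc k) * e"
    by (metis cong_iff_lin cong_sym)
  have "g ^ l ^ (Suc k - w) = (1 + d) ^ l"
    unfolding d_def c(1)[symmetric] power_mult[symmetric]
    using step(1) by (simp add: Suc_diff_le mult.commute)
  also have "\<dots> = 1 + int l ^ Suc k * (c + int l * e)"
    unfolding e by (simp add: d_def algebra_simps)
  finally show ?case
    using c(2) by (intro exI[of _ "c + int l * e"]) (simp add: dvd_add_left_iff)
qed

text \<open>To first order exponents act additively: \<open>s\<close> contributes
  \<open>s * c\<close> to the digit of index \<open>k\<close>. The square drops out since
  \<open>2 * k \<ge> k + 1\<close>.\<close>

lemma power_l_power_cong:
  assumes "w \<le> k" "g ^ l ^ (k - w) = 1 + int l ^ k * c"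
  shows "[g ^ (l ^ (k - w) * s) = 1 + int l ^ k * (int s * c)] (mod int l ^ Suc k)"
proof -
  have "Suc k \<le> 2 * k" using w_pos assms(1) by simp
  then have "int l ^ Suc k dvd (int l ^ k * c)\<^sup>2"
    by (auto simp: power_mult_distrib mult.commute simp flip: power_mult
        intro!: dvd_mult2 dvd_mult le_imp_power_dvd simp del: power_Suc)
  with power_one_plus_cong_square[of "int l ^ k * c" s]
  have "[(1 + int l ^ k * c) ^ s = 1 + int s * (int l ^ k * c)] (mod int l ^ Suc k)"
    by (rule cong_dvd_modulus)
  then show ?thesis by (simp add: power_mult assms(2) mult.left_commute)
qed

text \<open>Lifting the exponent, stated as a divisibility. For \<open>k \<le> w\<close> truncated
  subtraction makes the right side trivially true, as the left side is.\<close>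

lemma power_dvd_power_minus_one_iff: "int l ^ k dvd g ^ s - 1 \<longleftrightarrow> l ^ (k - w) dvd s"
proof (cases "w \<le> k")
  case True
  then show ?thesis
  proof (induction k rule: dec_induct)
    case base
    have "g - 1 dvd g ^ s - 1" by (metis dvd_triv_left power_diff_1_eq)
    then show ?case using dvd_w by (auto intro: dvd_trans)
  next
    case (step k)
    obtain c where c: "g ^ l ^ (k - w) = 1 + int l ^ k * c" "\<not> int l dvd c"
      using power_l_power step(1) by blast
    \<comment> \<open>For exponents that already work modulo \<open>l ^ k\<close>, the next digit
      vanishes exactly when \<open>l\<close> divides \<open>s'\<close>, because \<open>c\<close> is
      a unit modulo \<open>l\<close>.\<close>
    have key: "int l ^ Suc k dvd g ^ (l ^ (k - w) * s') - 1 \<longleftrightarrow> l dvd s'" for s'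
    proof -
      have "int l ^ Suc k dvd g ^ (l ^ (k - w) * s') - 1
          \<longleftrightarrow> int l ^ Suc k dvd int l ^ k * (int s' * c)"
      proof (rule cong_dvd_iff)
        show "[g ^ (l ^ (k - w) * s') - 1 = int l ^ k * (int s' * c)] (mod int l ^ Suc k)"
          using cong_diff[OF power_l_power_cong[OF step(1) c(1), of s'] cong_refl[of 1]]
          by (simp del: power_Suc)
      qed
      also have "\<dots> \<longleftrightarrow> int l dvd int s' * c"
        using l_pos by (simp add: mult.commute[of "int l"])
      also have "\<dots> \<longleftrightarrow> l dvd s'"
        using c(2) prime_l by (simp add: prime_dvd_mult_iff)
      finally show ?thesis .
    qed
    have Sucw: "l ^ (Suc k - w) = l ^ (k - w) * l" using step(1) by (simp add: Suc_diff_le)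
    show ?case
    proof (cases "l ^ (k - w) dvd s")
      case True
      then obtain s' where "s = l ^ (k - w) * s'" by (elim dvdE)
      then show ?thesis using key[of s'] l_pos by (simp add: Sucw)
    next
      case False
      then have "\<not> int l ^ k dvd g ^ s - 1" using step.IH by simp
      then show ?thesis using False by (auto simp: Sucw intro: dvd_mult_left dvd_mult_right)
    qed
  qed
next
  case False
  have "g - 1 dvd g ^ s - 1" by (metis dvd_triv_left power_diff_1_eq)
  moreover have "int l ^ k dvd int l ^ w" using False by (simp add: le_imp_power_dvd)
  ultimately show ?thesis using dvd_w False by (auto intro: dvd_trans)
qed

lemma coprime_g: "coprime g (int l)"
proof -
  have "int l dvd g - 1" using dvd_w w_pos by (auto intro: dvd_trans[rotated] simp: dvd_power)
  then have "[g = 1] (mod int l)" by (simp add: cong_iff_dvd_diff)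
  then show ?thesis by (metis cong_imp_coprime cong_sym coprime_1_left)
qed

text \<open>Digit by digit: a further exponent \<open>l ^ (k - w) * s\<close> keeps
  \<open>g ^ j\<close> modulo \<open>l ^ k\<close> and adds \<open>c * g ^ j * s\<close> to the
  digit of index \<open>k\<close>, so a suitable \<open>s\<close> solves a linear congruence modulo
  \<open>l\<close>.\<close>

lemma power_surj:
  assumes "[x = 1] (mod int l ^ w)"
  shows "\<exists>j. [x = g ^ j] (mod int l ^ k)"
proof -
  have "\<exists>j. [x = g ^ j] (mod int l ^ k)" if "w \<le> k" for k
    using that
  proof (induction k rule: dec_induct)
    case base
    show ?case using assms by (intro exI[of _ 0]) simp
  next
    case (step k)
    then obtain j where j: "[x = g ^ j] (mod int l ^ k)" by blast
    then obtain b where b: "x = g ^ j + int l ^ k * b" by (metis cong_iff_lin cong_sym)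
    obtain c where c: "g ^ l ^ (k - w) = 1 + int l ^ k * c" "\<not> int l dvd c"
      using power_l_power step(1) by blast
    have "coprime (c * g ^ j) (int l)"
      using c(2) prime_l coprime_g prime_imp_coprime[of "int l" c]
      by (simp add: coprime_commute)
    then obtain s0 where s0: "[c * g ^ j * s0 = b] (mod int l)"
      by (metis cong_solve_coprime_int cong_scalar_right mult.assoc mult_1 )
    define s where "s = nat (s0 mod int l)"
    have "int s = s0 mod int l" using l_pos by (simp add: s_def)
    then have "[c * g ^ j * int s = b] (mod int l)"
      using s0 by (simp add: cong_def mod_mult_right_eq)
    then obtain f where f: "c * g ^ j * int s = b + int l * f" by (metis cong_iff_lin cong_sym)
    have "[g ^ j * g ^ (l ^ (k - w) * s) = g ^ j * (1 + int l ^ k * (int s * c))] (mod int l ^ Suc k)"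
      by (intro cong_scalar_left power_l_power_cong step c)
    also have "g ^ j * (1 + int l ^ k * (int s * c)) = g ^ j + int l ^ k * (c * g ^ j * int s)"
      by (simp add: algebra_simps)
    also have "\<dots> = x + int l ^ Suc k * f" unfolding f b by (simp add: algebra_simps)
    also have "[\<dots> = x] (mod int l ^ Suc k)" by (simp add: cong_def del: power_Suc)
    finally have "[x = g ^ (j + l ^ (k - w) * s)] (mod int l ^ Suc k)"
      by (simp add: power_add cong_sym del: power_Suc)
    then show ?case by blast
  qed
  from this[of "max w k"] obtain j where "[x = g ^ j] (mod int l ^ max w k)" by auto
  then have "[x = g ^ j] (mod int l ^ k)" by (rule cong_dvd_modulus) (simp add: le_imp_power_dvd)
  then show ?thesis by blast
qed

end

section \<open>Representatives of the quotient of the unit group\<close>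

lemma units_of_residue_ring_pow:
  assumes "prime l" "coprime g (int l)"
  shows "(g mod int l) [^]\<^bsub>units_of (residue_ring (int l))\<^esub> k = g ^ k mod int l"
proof -
  interpret residues_prime l "residue_ring (int l)"
    by (simp_all add: residues_prime_def assms)
  have "g mod int l \<in> Units (residue_ring (int l))"
    using assms(2) prime_gt_1_int[of "int l"] assms(1) by (simp add: coprime_commute)
  then show ?thesis by (simp add: units_of_pow pow_cong)
qed

lemma generate_units_of_residue_ring:
  assumes "prime l" "coprime g (int l)"
  defines "G \<equiv> units_of (residue_ring (int l))"
  shows "group G" "g mod int l \<in> carrier G" "finite (carrier G)" "order G = l - 1"
    and "generate G {g mod int l} = range (\<lambda>k. g ^ k mod int l)"
proof -
  interpret residues_prime l "residue_ring (int l)"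
    by (simp_all add: residues_prime_def assms)
  show grp: "group G" unfolding G_def by (rule units_group)
  then interpret G: group G .
  show a: "g mod int l \<in> carrier G"
    using assms prime_gt_1_int[of "int l"] by (simp add: units_of_carrier coprime_commute)
  have carr: "carrier G = Units (residue_ring (int l))" by (simp add: G_def units_of_carrier)
  show fin: "finite (carrier G)" by (simp add: carr finite_Units)
  show "order G = l - 1"
    using totient_eq totient_prime[OF assms(1)] by (simp add: order_def carr)
  show "generate G {g mod int l} = range (\<lambda>k. g ^ k mod int l)"
    using G.generate_pow_on_finite_carrier[OF fin a] units_of_residue_ring_pow[OF assms(1,2)]
    by (auto simp: G_def)
qed

lemma card_generate_units_of_residue_ring:
  assumes "prime l" "coprime g l"
  shows "card (generate (units_of (residue_ring (int l))) {int g mod int l}) = Pocklington.ord l g"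
proof -
  define G where "G = units_of (residue_ring (int l))"
  have cop: "coprime (int g) (int l)" using assms(2) by simp
  note gen = generate_units_of_residue_ring[OF assms(1) cop, folded G_def]
  interpret group G by (rule gen)
  have "(int g mod int l) [^]\<^bsub>G\<^esub> k = \<one>\<^bsub>G\<^esub> \<longleftrightarrow> Pocklington.ord l g dvd k" for k
  proof -
    have "(int g mod int l) [^]\<^bsub>G\<^esub> k = \<one>\<^bsub>G\<^esub> \<longleftrightarrow> [int g ^ k = 1] (mod int l)"
      using units_of_residue_ring_pow[OF assms(1) cop, of k] prime_gt_1_int[of "int l"] assms(1)
      by (simp add: G_def units_of_one residue_ring_def cong_def)
    also have "\<dots> \<longleftrightarrow> Pocklington.ord l g dvd k"
      by (metis cong_int_iff of_nat_1 of_nat_power ord_divides)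
    finally show ?thesis .
  qed
  then have iff: "group.ord G (int g mod int l) dvd k \<longleftrightarrow> Pocklington.ord l g dvd k" for k
    using pow_eq_id[OF gen(2)] by simp
  from iff[of "Pocklington.ord l g"] iff[of "group.ord G (int g mod int l)"]
  have "group.ord G (int g mod int l) = Pocklington.ord l g" by (simp add: dvd_antisym)
  then show ?thesis using generate_pow_card[OF gen(2)] by (simp add: G_def)
qed

text \<open>Lagrange's theorem links the count in \<open>num_reps\<close> with the quotient behind
  \<open>unit_quot_reps\<close>, so that the indices from 1 to \<open>num_reps\<close> run through
  all of \<open>S\<close>.\<close>

lemma unit_quot_reps_card:
  assumes "prime l" "coprime g l" "unit_quot_reps l (int g) S"
  shows "card S = (l - 1) div Pocklington.ord l g"
proof -
  define G where "G = units_of (residue_ring (int l))"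
  define H where "H = generate G {int g mod int l}"
  have cop: "coprime (int g) (int l)" using assms(2) by simp
  note gen = generate_units_of_residue_ring[OF assms(1) cop, folded G_def]
  interpret group G by (rule gen)
  have "subgroup H G"
    unfolding H_def by (rule generate_is_subgroup) (use gen(2) in simp)
  then have "card (rcosets\<^bsub>G\<^esub> H) * card H = l - 1"
    using lagrange gen(4) by simp
  moreover have "card H = Pocklington.ord l g"
    using card_generate_units_of_residue_ring[OF assms(1,2)] by (simp add: H_def G_def)
  moreover have "card S = card (rcosets\<^bsub>G\<^esub> H)"
    using assms(3) by (auto simp: unit_quot_reps_def Let_def FactGroup_def H_def G_def
        intro: bij_betw_same_card)
  moreover have "0 < Pocklington.ord l g" using assms(2) by (simp add: coprime_commute)
  ultimately show ?thesis by (metis nonzero_mult_div_cancel_right less_numeral_extra(3))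
qed

text \<open>The coset of \<open>d\<close> is represented by some \<open>s\<close> in
  \<open>S\<close>; then \<open>s\<close> lies in this coset, that is, \<open>s\<close> is
  \<open>d\<close> times a power of \<open>g\<close>.\<close>

lemma unit_quot_reps_cover:
  assumes "prime l" "coprime g (int l)" "unit_quot_reps l g S" "coprime d (int l)"
  shows "\<exists>s\<in>S. \<exists>j. [d * g ^ j = s] (mod int l)"
proof -
  define G where "G = units_of (residue_ring (int l))"
  define H where "H = generate G {g mod int l}"
  note gen = generate_units_of_residue_ring[OF assms(1,2), folded G_def]
  interpret group G by (rule gen)
  have sub: "subgroup H G"
    unfolding H_def by (rule generate_is_subgroup) (use gen(2) in simp)
  have d: "d mod int l \<in> carrier G"
    using generate_units_of_residue_ring(2)[OF assms(1,4)] by (simp add: G_def)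
  then have "H #>\<^bsub>G\<^esub> (d mod int l) \<in> rcosets\<^bsub>G\<^esub> H" by (auto simp: RCOSETS_def)
  moreover have "bij_betw (\<lambda>s. H #>\<^bsub>G\<^esub> s) S (rcosets\<^bsub>G\<^esub> H)" and S: "S \<subseteq> {1..int l - 1}"
    using assms(3) by (auto simp: unit_quot_reps_def Let_def FactGroup_def H_def G_def)
  ultimately obtain s where s: "s \<in> S" "H #>\<^bsub>G\<^esub> s = H #>\<^bsub>G\<^esub> (d mod int l)"
    unfolding bij_betw_def by (metis imageE)
  have "coprime s (int l)"
    using S s(1) assms(1) prime_imp_coprime[of "int l" s]
    by (auto simp: coprime_commute zdvd_not_zless)
  moreover have "s mod int l = s" using S s(1) by auto
  ultimately have "s \<in> carrier G"
    using generate_units_of_residue_ring(2)[OF assms(1), of s] by (simp add: G_def)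
  then have "s \<in> H #>\<^bsub>G\<^esub> (d mod int l)" using rcos_self[OF _ sub] s(2) by blast
  then obtain j where "s = (g ^ j mod int l) \<otimes>\<^bsub>G\<^esub> (d mod int l)"
    by (auto simp: r_coset_def H_def gen(5))
  then have "s = (d * g ^ j) mod int l"
    by (simp add: G_def units_of_mult residue_ring_def mod_simps mult.commute)
  then have "[d * g ^ j = s] (mod int l)" by (simp add: cong_def)
  then show ?thesis using s(1) by blast
qed

section \<open>Splitting types along the tower\<close>

text \<open>Divisibility replaces the valuations; the value infinity at 0 matches the fact that
  everything divides 0.\<close>

lemma val_add_ge_iff:
  assumes "prime l"
  shows "enat k \<le> val l x + val l y \<longleftrightarrow> int l ^ k dvd x * y"
proof (cases "x = 0 \<or> y = 0")
  case True
  then show ?thesis by (auto simp: val_def)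
next
  case False
  have "prime_elem (int l)" using assms by simp
  then have "multiplicity (int l) (x * y) = multiplicity (int l) x + multiplicity (int l) y"
    using False by (intro prime_elem_multiplicity_mult_distrib) auto
  moreover have "\<not> is_unit (int l)" using prime_gt_1_nat[OF assms] by simp
  ultimately show ?thesis using False
    by (simp add: val_def power_dvd_iff_le_multiplicity)
qed

section \<open>The expansion of \<open>- \<gamma> / n\<close> and divisibility by powers of
  \<open>l\<close>\<close>

lemma phi_trunc_eq:
  assumes "coprime l n" "0 < l"
  shows "phi_trunc l n \<gamma> i = phi l n \<gamma> i"
  unfolding phi_trunc_def phi_digit_def by (rule padic_digit_expansion) (rule phi_spec[OF assms])

lemma dvd_add_phi_trunc:
  assumes "coprime l n" "0 < l"
  shows "int l ^ i dvd \<gamma> + int n * phi_trunc l n \<gamma> i"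
proof -
  have "[int n * phi l n \<gamma> i = - \<gamma>] (mod int l ^ i)"
    using fun_cong[OF phi_spec(2)[OF assms, of \<gamma>], of i]
    by (simp add: padic_ring_def padic_of_int_def cong_def mod_simps)
  then show ?thesis by (simp add: phi_trunc_eq[OF assms] cong_iff_dvd_diff add.commute)
qed

lemma phi_digit_range:
  assumes "coprime l n" "0 < l"
  shows "phi_digit l n \<gamma> k \<in> {0..int l - 1}"
  unfolding phi_digit_def by (rule padic_digit_range) (use phi_spec[OF assms] assms in auto)

text \<open>As \<open>n\<close> is a unit modulo \<open>l ^ i\<close>, the truncation is the only
  solution. The valuation of \<open>\<gamma> + n * z\<close> thus counts the initial digits that
  \<open>z\<close> shares with \<open>- \<gamma> / n\<close>.\<close>

lemma dvd_add_mult_iff_cong_phi_trunc: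
  assumes "coprime l n" "0 < l"
  shows "int l ^ i dvd \<gamma> + int n * z \<longleftrightarrow> [z = phi_trunc l n \<gamma> i] (mod int l ^ i)"
proof -
  have "int l ^ i dvd \<gamma> + int n * z \<longleftrightarrow>
      int l ^ i dvd (\<gamma> + int n * z) - (\<gamma> + int n * phi_trunc l n \<gamma> i)"
    using dvd_add_phi_trunc[OF assms] by (metis dvd_diff_left_iff)
  also have "(\<gamma> + int n * z) - (\<gamma> + int n * phi_trunc l n \<gamma> i) = int n * (z - phi_trunc l n \<gamma> i)"
    by (simp add: algebra_simps)
  also have "int l ^ i dvd \<dots> \<longleftrightarrow> int l ^ i dvd z - phi_trunc l n \<gamma> i"
    by (rule coprime_dvd_mult_right_iff) (use assms in simp)
  finally show ?thesis by (simp add: cong_iff_dvd_diff)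
qed

text \<open>The bound \<open>1 < q\<close> keeps \<open>q ^ s - 1\<close> nonzero for
  \<open>s > 0\<close>, so that \<open>multiplicity\<close>, which is 0 at 0, gives the true
  valuation in \<open>vexp\<close>.\<close>

locale cyclotomic_tower =
  fixes q l n :: nat
  assumes prime_l: "prime l" and odd_l: "odd l" and n_pos: "0 < n"
    and coprime_q_l: "coprime q l" and coprime_q_n: "coprime q n" and coprime_l_n: "coprime l n"
    and q_gt_1: "1 < q"
begin

abbreviation tau :: "int \<Rightarrow> nat" where "tau \<equiv> csize q n"
abbreviation D :: "int \<Rightarrow> nat" where "D y \<equiv> ord l (q ^ tau y)"
abbreviation w :: "int \<Rightarrow> nat" where "w \<equiv> vexp q l n"

lemma l_pos: "0 < l" using prime_l by (rule prime_gt_0_nat)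

lemma modulus_pos: "0 < l ^ i * n" using l_pos n_pos by simp

lemma coprime_q_modulus: "coprime q (l ^ i * n)"
  using coprime_q_l coprime_q_n by simp

lemma tau_eq: "tau y = cyc_period q n y"
  unfolding csize_def by (rule card_cyc_coset[OF coprime_q_n n_pos])

lemma tau_pos: "0 < tau y"
  unfolding tau_eq by (rule cyc_period_props[OF coprime_q_n n_pos])

lemma tau_cong: "[y = z] (mod int n) \<Longrightarrow> tau y = tau z"
  unfolding csize_def by (simp add: cyc_coset_cong[OF _ coprime_q_n n_pos])

lemma D_pos: "0 < D y" using coprime_q_l by (simp add: coprime_commute)

lemma w_cong: "[y = z] (mod int n) \<Longrightarrow> w y = w z"
  by (simp add: vexp_def tau_cong)

lemma dvd_power_tau_iff: "int l dvd int q ^ (tau y * s) - 1 \<longleftrightarrow> D y dvd s"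
proof -
  have "int l dvd int q ^ (tau y * s) - 1 \<longleftrightarrow> [int ((q ^ tau y) ^ s) = int 1] (mod int l)"
    by (simp add: cong_iff_dvd_diff power_mult)
  also have "\<dots> \<longleftrightarrow> D y dvd s" unfolding cong_int_iff by (rule ord_divides)
  finally show ?thesis .
qed

lemma D_eq_1: "int l dvd int q ^ tau y - 1 \<Longrightarrow> D y = 1"
  using dvd_power_tau_iff[of y 1] by simp

text \<open>If \<open>l\<close> divides \<open>q ^ tau y - 1\<close> then \<open>D y = 1\<close>, so
  both branches of \<open>vexp\<close> are one formula.\<close>

lemma w_eq: "w y = multiplicity (int l) (int q ^ (tau y * D y) - 1)"
  using D_eq_1[of y] by (auto simp: vexp_def Let_def)

text \<open>By the choice of \<open>D y\<close>, \<open>l\<close> divides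
  \<open>q ^ (tau y * D y) - 1\<close>, hence \<open>w y > 0\<close>. This makes the lifting results
  available for each \<open>y\<close>.\<close>

sublocale pow: odd_prime_unit l "int q ^ (tau y * D y)" "w y" for y
proof
  have nz: "int q ^ (tau y * D y) - 1 \<noteq> 0"
  proof -
    have "0 < tau y * D y" by (rule mult_pos_pos[OF tau_pos D_pos])
    then have "1 < int q ^ (tau y * D y)" using q_gt_1 by (intro one_less_power) auto
    then show ?thesis by simp
  qed
  have nu: "\<not> is_unit (int l)" using prime_gt_1_nat[OF prime_l] by simp
  have "int l ^ 1 dvd int q ^ (tau y * D y) - 1" using dvd_power_tau_iff by simp
  then show "0 < w y"
    using power_dvd_iff_le_multiplicity[OF nz nu, of 1] by (simp add: w_eq)
  show "int l ^ w y dvd int q ^ (tau y * D y) - 1" by (simp add: w_eq multiplicity_dvd)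
  show "\<not> int l ^ Suc (w y) dvd int q ^ (tau y * D y) - 1"
    using power_dvd_iff_le_multiplicity[OF nz nu, of "Suc (w y)"] by (simp add: w_eq)
qed (use prime_l odd_l in auto)

text \<open>A positive power of \<open>l\<close> forces \<open>D y dvd s\<close>; lifting the
  exponent then applies to the base \<open>q ^ (tau y * D y)\<close> and the exponent
  \<open>s / D y\<close>.\<close>

lemma power_dvd_power_tau_iff:
  assumes "0 < k"
  shows "int l ^ k dvd int q ^ (tau y * s) - 1 \<longleftrightarrow> D y * l ^ (k - w y) dvd s"
proof (cases "D y dvd s")
  case True
  then obtain r where "s = D y * r" by (elim dvdE)
  then show ?thesis
    using pow.power_dvd_power_minus_one_iff[of k y r] dvd_mult_cancel_left[of "D y"] D_pos[of y]
    by (simp add: power_mult del: ord_gt_0_iff)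
next
  case False
  have "int l dvd int l ^ k" using assms by simp
  then show ?thesis using False dvd_power_tau_iff[of y s] by (metis dvd_mult_left dvd_trans)
qed

section \<open>Periods modulo \<open>l ^ i * n\<close>\<close>

lemma cong_modulus_iff:
  "[x = y] (mod int l ^ i * int n) \<longleftrightarrow> [x = y] (mod int l ^ i) \<and> [x = y] (mod int n)"
proof
  assume "[x = y] (mod int l ^ i * int n)"
  then show "[x = y] (mod int l ^ i) \<and> [x = y] (mod int n)"
    by (metis cong_dvd_modulus dvd_triv_left dvd_triv_right)
next
  have "coprime (int l ^ i) (int n)" using coprime_l_n by simp
  then show "[x = y] (mod int l ^ i) \<and> [x = y] (mod int n) \<Longrightarrow> [x = y] (mod int l ^ i * int n)"
    by (simp add: coprime_cong_mult)
qed

text \<open>Modulo \<open>l ^ i\<close> the element is 0, so only the congruence modulo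
  \<open>n\<close> restricts the exponent.\<close>

lemma cyc_period_low:
  assumes "int l ^ i dvd y"
  shows "cyc_period q (l ^ i * n) y = tau y"
proof (rule cyc_period_eqI[OF coprime_q_modulus modulus_pos])
  fix t
  have "[y * int q ^ t = y] (mod int l ^ i)"
    using assms by (simp add: cong_def)
  then show "[y * int q ^ t = y] (mod int (l ^ i * n)) \<longleftrightarrow> tau y dvd t"
    by (simp add: cong_modulus_iff cong_iff_cyc_period_dvd[OF coprime_q_n n_pos] tau_eq)
qed

lemma power_dvd_mult_iff:
  assumes "int l ^ m dvd y" "\<not> int l ^ Suc m dvd y"
  shows "int l ^ (m + k) dvd y * z \<longleftrightarrow> int l ^ k dvd z"
proof -
  obtain y0 where y0: "y = int l ^ m * y0" using assms(1) by (elim dvdE)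
  then have "\<not> int l dvd y0" using assms(2) l_pos by (simp add: mult.commute[of "int l"])
  then have "coprime (int l ^ k) y0"
    using prime_l by (simp add: prime_imp_coprime)
  then show ?thesis using l_pos
    by (simp add: y0 power_add mult.assoc coprime_dvd_mult_right_iff)
qed

text \<open>The congruence modulo \<open>n\<close> requires \<open>tau y dvd t\<close>. In the one
  modulo \<open>l ^ i\<close> the valuation \<open>m\<close> of \<open>y\<close> cancels, leaving
  divisibility of \<open>q ^ t - 1\<close> by \<open>l ^ (i - m)\<close>, a positive power as
  \<open>m < i\<close>.\<close>

lemma cyc_period_high:
  assumes "int l ^ m dvd y" "\<not> int l ^ Suc m dvd y" "m < i"
  shows "cyc_period q (l ^ i * n) y = tau y * (D y * l ^ (i - m - w y))"
proof (rule cyc_period_eqI[OF coprime_q_modulus modulus_pos])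
  fix t
  have n: "[y * int q ^ t = y] (mod int n) \<longleftrightarrow> tau y dvd t"
    by (simp add: cong_iff_cyc_period_dvd[OF coprime_q_n n_pos] tau_eq)
  have "[y * int q ^ t = y] (mod int l ^ i) \<longleftrightarrow> int l ^ (m + (i - m)) dvd y * (int q ^ t - 1)"
    using assms(3) by (simp add: cong_iff_dvd_diff algebra_simps)
  also have "\<dots> \<longleftrightarrow> int l ^ (i - m) dvd int q ^ t - 1"
    by (rule power_dvd_mult_iff[OF assms(1,2)])
  finally have l: "[y * int q ^ t = y] (mod int l ^ i) \<longleftrightarrow> int l ^ (i - m) dvd int q ^ t - 1" .
  show "[y * int q ^ t = y] (mod int (l ^ i * n)) \<longleftrightarrow> tau y * (D y * l ^ (i - m - w y)) dvd t"
  proof (cases "tau y dvd t")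
    case True
    then obtain s where s: "t = tau y * s" by (elim dvdE)
    show ?thesis
      using power_dvd_power_tau_iff[of "i - m" y s] assms(3) tau_pos[of y]
      by (simp add: cong_modulus_iff n l) (simp add: s)
  next
    case False
    then show ?thesis by (auto simp: cong_modulus_iff n dest: dvd_mult_left)
  qed
qed

text \<open>The choice of representative in \<open>splitting\<close> does not matter: any other
  differs from some \<open>y * q ^ j\<close> by a multiple of \<open>l ^ i\<close>, the factor
  \<open>z\<close> supplies one more \<open>l\<close>, and \<open>q\<close> is prime to
  \<open>l\<close>.\<close>

lemma splitting_iff:
  fixes i y
  defines "z \<equiv> int q ^ cyc_period q (l ^ i * n) y - 1"
  shows "splitting q l (l ^ i * n) (cyc_coset q (l ^ i * n) y) \<longleftrightarrow>
    int l dvd z \<and> int l ^ Suc i dvd y * z"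
proof -
  have "val l (int (l ^ i * n)) + 1 = enat (Suc i)"
  proof -
    have "\<not> int l dvd int n" using coprime_l_n prime_l by (auto simp: prime_nat_iff coprime_absorb_left)
    then have "multiplicity (int l) (int (l ^ i * n)) = i"
      using prime_l by (intro multiplicity_eqI) (auto simp: l_pos)
    then show ?thesis using l_pos n_pos by (simp add: val_def one_enat_def)
  qed
  then have val: "val l \<delta> + val l z \<ge> val l (int (l ^ i * n)) + 1 \<longleftrightarrow> int l ^ Suc i dvd \<delta> * z" for \<delta>
    using val_add_ge_iff[OF prime_l] by metis
  have "int l ^ Suc i dvd \<delta> * z \<longleftrightarrow> int l ^ Suc i dvd y * z"
    if *: "cyc_coset q (l ^ i * n) \<delta> = cyc_coset q (l ^ i * n) y" and dvd: "int l dvd z" for \<delta>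
  proof -
    obtain j where "[\<delta> = y * int q ^ j] (mod int (l ^ i * n))"
      using * cyc_coset_eq_iff[OF coprime_q_modulus modulus_pos] by blast
    then have "int l ^ i * int l dvd (\<delta> - y * int q ^ j) * z"
      using dvd by (intro mult_dvd_mono) (auto simp: cong_modulus_iff cong_iff_dvd_diff)
    then have "[\<delta> * z = y * int q ^ j * z] (mod int l ^ Suc i)"
      by (simp only: cong_iff_dvd_diff left_diff_distrib power_Suc2)
    then have "int l ^ Suc i dvd \<delta> * z \<longleftrightarrow> int l ^ Suc i dvd y * int q ^ j * z"
      by (rule cong_dvd_iff)
    also have "y * int q ^ j * z = int q ^ j * (y * z)" by simp
    also have "int l ^ Suc i dvd \<dots> \<longleftrightarrow> int l ^ Suc i dvd y * z"
      using coprime_q_l by (intro coprime_dvd_mult_right_iff) (simp add: coprime_commute del: power_Suc)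
    finally show ?thesis .
  qed
  then show ?thesis
    unfolding splitting_def card_cyc_coset[OF coprime_q_modulus modulus_pos] z_def[symmetric] val
    by blast
qed

lemma splitting_type_low:
  assumes "int l ^ i dvd y"
  shows "splitting q l (l ^ i * n) (cyc_coset q (l ^ i * n) y) \<longleftrightarrow> int l dvd int q ^ tau y - 1"
    and "semi_splitting q l (l ^ i * n) (cyc_coset q (l ^ i * n) y) \<longleftrightarrow> \<not> int l dvd int q ^ tau y - 1"
proof -
  have "int l ^ Suc i dvd y * z" if "int l dvd z" for z
    unfolding power_Suc2 using assms that by (rule mult_dvd_mono)
  then show "splitting q l (l ^ i * n) (cyc_coset q (l ^ i * n) y) \<longleftrightarrow> int l dvd int q ^ tau y - 1"
    unfolding splitting_iff cyc_period_low[OF assms] by blast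
  show "semi_splitting q l (l ^ i * n) (cyc_coset q (l ^ i * n) y) \<longleftrightarrow> \<not> int l dvd int q ^ tau y - 1"
    unfolding semi_splitting_def card_cyc_coset[OF coprime_q_modulus modulus_pos]
      cyc_period_low[OF assms] by (rule refl)
qed

text \<open>By the period formula, splitting means that \<open>D y * l ^ (i + 1 - m - w y)\<close>
  divides \<open>D y * l ^ (i - m - w y)\<close>.\<close>

lemma splitting_type_high:
  assumes "int l ^ m dvd y" "\<not> int l ^ Suc m dvd y" "m < i"
  shows "splitting q l (l ^ i * n) (cyc_coset q (l ^ i * n) y) \<longleftrightarrow> i < m + w y"
    and "nonsplitting q l (l ^ i * n) (cyc_coset q (l ^ i * n) y) \<longleftrightarrow> m + w y \<le> i"
    and "\<not> semi_splitting q l (l ^ i * n) (cyc_coset q (l ^ i * n) y)"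
proof -
  define c where "c = cyc_period q (l ^ i * n) y"
  have c: "c = tau y * (D y * l ^ (i - m - w y))"
    unfolding c_def by (rule cyc_period_high[OF assms])
  then have dvd: "int l dvd int q ^ c - 1" using dvd_power_tau_iff by simp
  have "int l ^ Suc i dvd y * (int q ^ c - 1) \<longleftrightarrow> int l ^ (Suc i - m) dvd int q ^ c - 1"
    using power_dvd_mult_iff[OF assms(1,2), of "Suc i - m"] assms(3) by simp
  also have "\<dots> \<longleftrightarrow> D y * l ^ (Suc i - m - w y) dvd D y * l ^ (i - m - w y)"
    unfolding c by (rule power_dvd_power_tau_iff) (use assms(3) in simp)
  also have "\<dots> \<longleftrightarrow> Suc i - m - w y \<le> i - m - w y"
    using dvd_mult_cancel_left[of "D y"] D_pos[of y] prime_gt_1_nat[OF prime_l]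
    by (simp add: dvd_power_iff_le del: ord_gt_0_iff)
  \<comment> \<open>With truncated subtraction both sides are 0 if \<open>i < m + w y\<close>;
    otherwise the left one is larger by 1.\<close>
  also have "\<dots> \<longleftrightarrow> i < m + w y" using assms(3) by auto
  finally show split: "splitting q l (l ^ i * n) (cyc_coset q (l ^ i * n) y) \<longleftrightarrow> i < m + w y"
    using dvd by (simp add: splitting_iff flip: c_def)
  show "nonsplitting q l (l ^ i * n) (cyc_coset q (l ^ i * n) y) \<longleftrightarrow> m + w y \<le> i"
    "\<not> semi_splitting q l (l ^ i * n) (cyc_coset q (l ^ i * n) y)"
    using dvd split by (auto simp: nonsplitting_def semi_splitting_def
        card_cyc_coset[OF coprime_q_modulus modulus_pos] simp flip: c_def)
qed

end

section \<open>The decomposition\<close>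

lemma nth_sorted_list_of_set_image:
  fixes A :: "'a::linorder set"
  assumes "finite A" "card A = r"
  shows "(\<lambda>a. sorted_list_of_set A ! (a - 1)) ` {1..r} = A"
proof -
  have "(\<lambda>a. sorted_list_of_set A ! (a - 1)) ` Suc ` {..<r} = (!) (sorted_list_of_set A) ` {..<r}"
    by (simp add: image_image)
  also have "\<dots> = A" using assms nth_image[of r "sorted_list_of_set A"]
    by (simp add: lessThan_atLeast0)
  finally show ?thesis unfolding image_Suc_lessThan .
qed

text \<open>Lets the index of a part, infinity included, be recovered from tests at finite
  degrees.\<close>

lemma enat_eqI:
  fixes m k :: enat
  assumes "\<And>i. enat i \<le> m \<longleftrightarrow> enat i \<le> k"
  shows "m = k"
proof -
  have le: "a \<le> b" if "\<And>i. enat i \<le> a \<Longrightarrow> enat i \<le> b" for a b :: enat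
  proof (rule ccontr)
    assume "\<not> a \<le> b"
    then obtain j where j: "b = enat j" "b < a" by (cases b) auto
    then have "enat (Suc j) \<le> a" by (cases a) auto
    then show False using that[of "Suc j"] j(1) by simp
  qed
  show ?thesis by (rule antisym; rule le) (simp_all add: assms)
qed

context cyclotomic_tower
begin

section \<open>Leading digits and the valuation they produce\<close>

lemma phi_trunc_Suc: "phi_trunc l n \<gamma> (Suc m) = phi_trunc l n \<gamma> m + phi_digit l n \<gamma> m * int l ^ m"
  by (simp add: phi_trunc_def)

text \<open>The disjunction lets both cases share one hypothesis: quotient representatives are
  called for only when \<open>q ^ tau \<gamma>\<close> is not 1 modulo \<open>l\<close>.\<close>

definition digit_reps :: "int \<Rightarrow> int set \<Rightarrow> bool" where
  "digit_reps \<gamma> S \<longleftrightarrow> int l dvd int q ^ tau \<gamma> - 1 \<or> unit_quot_reps l (int q ^ tau \<gamma>) S"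

lemma lead_digit_image_dvd:
  assumes "int l dvd int q ^ tau \<gamma> - 1"
  shows "lead_digit q l n S \<gamma> m ` {1..num_reps q l n \<gamma>} = {0..int l - 1} - {phi_digit l n \<gamma> m}"
proof -
  have "num_reps q l n \<gamma> = l - 1" using D_eq_1[OF assms] by (simp add: num_reps_def)
  then have "card ({0..int l - 1} - {phi_digit l n \<gamma> m}) = num_reps q l n \<gamma>"
    using phi_digit_range[OF coprime_l_n l_pos] by simp
  then show ?thesis
    using assms nth_sorted_list_of_set_image[of "{0..int l - 1} - {phi_digit l n \<gamma> m}"]
    by (simp add: lead_digit_def)
qed

lemma lead_digit_image_not_dvd:
  assumes "\<not> int l dvd int q ^ tau \<gamma> - 1" "unit_quot_reps l (int q ^ tau \<gamma>) S"
  shows "lead_digit q l n S \<gamma> m ` {1..num_reps q l n \<gamma>} = (\<lambda>s. (phi_digit l n \<gamma> m + s) mod int l) ` S"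
proof -
  have "finite S" using assms(2) finite_subset[of S "{1..int l - 1}"] by (simp add: unit_quot_reps_def)
  moreover have "card S = num_reps q l n \<gamma>"
    using unit_quot_reps_card[OF prime_l, of "q ^ tau \<gamma>" S] assms(2) coprime_q_l
    by (simp add: num_reps_def)
  ultimately have "S = (\<lambda>a. sorted_list_of_set S ! (a - 1)) ` {1..num_reps q l n \<gamma>}"
    using nth_sorted_list_of_set_image by metis
  then have "(\<lambda>s. (phi_digit l n \<gamma> m + s) mod int l) ` S =
      (\<lambda>s. (phi_digit l n \<gamma> m + s) mod int l) ` (\<lambda>a. sorted_list_of_set S ! (a - 1)) ` {1..num_reps q l n \<gamma>}"
    by simp
  also have "\<dots> = lead_digit q l n S \<gamma> m ` {1..num_reps q l n \<gamma>}"
    unfolding image_image using assms(1) by (simp add: lead_digit_def)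
  finally show ?thesis by simp
qed

text \<open>Leaving the expansion of \<open>- \<gamma> / n\<close> at index \<open>m\<close> is what
  stops the valuation at \<open>m\<close>. A shift by \<open>s\<close> in \<open>S\<close> does so
  because \<open>0 < s < l\<close>.\<close>

lemma lead_digit_not_cong:
  assumes "digit_reps \<gamma> S"
    and "a \<in> {1..num_reps q l n \<gamma>}"
  shows "\<not> [lead_digit q l n S \<gamma> m a = phi_digit l n \<gamma> m] (mod int l)"
proof (cases "int l dvd int q ^ tau \<gamma> - 1")
  case True
  have "lead_digit q l n S \<gamma> m a \<in> {0..int l - 1} - {phi_digit l n \<gamma> m}"
    using assms(2) lead_digit_image_dvd[OF True, of S m] by blast
  moreover have "phi_digit l n \<gamma> m \<in> {0..int l - 1}" by (rule phi_digit_range[OF coprime_l_n l_pos])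
  ultimately show ?thesis by (simp add: cong_def)
next
  case False
  then have S: "unit_quot_reps l (int q ^ tau \<gamma>) S" using assms(1) by (simp add: digit_reps_def)
  then obtain s where s: "s \<in> S" "lead_digit q l n S \<gamma> m a = (phi_digit l n \<gamma> m + s) mod int l"
    using assms(2) lead_digit_image_not_dvd[OF False S, of m] by blast
  have "s \<in> {1..int l - 1}" using S s(1) by (auto simp: unit_quot_reps_def)
  then have "\<not> int l dvd s" by (simp add: zdvd_not_zless)
  moreover have "[phi_digit l n \<gamma> m + s = phi_digit l n \<gamma> m] (mod int l) \<longleftrightarrow> int l dvd s"
    by (simp add: cong_iff_dvd_diff)
  ultimately show ?thesis unfolding s(2) by simp
qed

text \<open>Normalises the digit of index \<open>m\<close>: \<open>d\<close> is its nonzero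
  deviation from the expansion, and powers of \<open>q ^ tau \<gamma>\<close> multiply
  \<open>d\<close> until a listed digit appears. If \<open>q ^ tau \<gamma>\<close> is 1 modulo
  \<open>l\<close>, all digits off the expansion are listed and \<open>j = 0\<close>
  suffices.\<close>

lemma lead_digit_cover:
  assumes "digit_reps \<gamma> S"
    and "\<not> int l dvd d"
  shows "\<exists>a\<in>{1..num_reps q l n \<gamma>}. \<exists>j.
    [phi_digit l n \<gamma> m + d * int q ^ (tau \<gamma> * j) = lead_digit q l n S \<gamma> m a] (mod int l)"
proof (cases "int l dvd int q ^ tau \<gamma> - 1")
  case True
  let ?\<phi> = "phi_digit l n \<gamma> m"
  have "(?\<phi> + d) mod int l \<noteq> ?\<phi>"
  proof
    assume "(?\<phi> + d) mod int l = ?\<phi>"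
    then have "[?\<phi> + d = ?\<phi>] (mod int l)" by (metis cong_mod_right cong_refl)
    then show False using assms(2) by (simp add: cong_iff_dvd_diff)
  qed
  moreover have "(?\<phi> + d) mod int l \<in> {0..int l - 1}"
    using l_pos pos_mod_bound[of "int l" "?\<phi> + d"] by simp
  ultimately have "(?\<phi> + d) mod int l \<in> lead_digit q l n S \<gamma> m ` {1..num_reps q l n \<gamma>}"
    unfolding lead_digit_image_dvd[OF True] by simp
  then obtain a where a: "a \<in> {1..num_reps q l n \<gamma>}" "(?\<phi> + d) mod int l = lead_digit q l n S \<gamma> m a"
    by blast
  have "[?\<phi> + d * int q ^ (tau \<gamma> * 0) = lead_digit q l n S \<gamma> m a] (mod int l)"
    unfolding a(2)[symmetric] by simp
  with a(1) show ?thesis by blast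
next
  case False
  then have S: "unit_quot_reps l (int q ^ tau \<gamma>) S" using assms(1) by (simp add: digit_reps_def)
  let ?\<phi> = "phi_digit l n \<gamma> m"
  have "coprime d (int l)"
    using prime_l assms(2) prime_imp_coprime[of "int l" d] by (simp add: coprime_commute)
  moreover have "coprime (int q ^ tau \<gamma>) (int l)" using coprime_q_l by simp
  ultimately obtain s j where s: "s \<in> S" "[d * (int q ^ tau \<gamma>) ^ j = s] (mod int l)"
    using unit_quot_reps_cover[OF prime_l _ S] by blast
  then have "(?\<phi> + s) mod int l \<in> lead_digit q l n S \<gamma> m ` {1..num_reps q l n \<gamma>}"
    unfolding lead_digit_image_not_dvd[OF False S] by blast
  then obtain a where a: "a \<in> {1..num_reps q l n \<gamma>}" "(?\<phi> + s) mod int l = lead_digit q l n S \<gamma> m a"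
    by blast
  have "[?\<phi> + d * int q ^ (tau \<gamma> * j) = ?\<phi> + s] (mod int l)"
    using s(2) by (simp add: power_mult cong_add_lcancel)
  then have "[?\<phi> + d * int q ^ (tau \<gamma> * j) = lead_digit q l n S \<gamma> m a] (mod int l)"
    unfolding a(2)[symmetric] by simp
  with a(1) show ?thesis by blast
qed

lemma Unum_eq: "Unum q l n S \<gamma> m a = phi_trunc l n \<gamma> m + lead_digit q l n S \<gamma> m a * int l ^ m"
  by (simp add: Unum_def phi_trunc_def)

text \<open>The first \<open>m\<close> digits agree with those of \<open>- \<gamma> / n\<close> and
  the next one does not; the term in \<open>t\<close> affects only later digits.\<close>

lemma seq_fin_valuation:
  fixes a m t :: nat
  assumes "digit_reps \<gamma> S"
    and "a \<in> {1..num_reps q l n \<gamma>}"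
  defines "y \<equiv> \<gamma> + int n * (Unum q l n S \<gamma> m a + int l ^ (m + 1) * int t)"
  shows "int l ^ m dvd y" "\<not> int l ^ Suc m dvd y"
proof -
  let ?u = "lead_digit q l n S \<gamma> m a" and ?\<phi> = "phi_digit l n \<gamma> m"
  let ?z = "Unum q l n S \<gamma> m a + int l ^ (m + 1) * int t"
  have "?z - phi_trunc l n \<gamma> m = int l ^ m * (?u + int l * int t)"
    by (simp add: Unum_eq algebra_simps)
  then have "[?z = phi_trunc l n \<gamma> m] (mod int l ^ m)" by (simp only: cong_iff_dvd_diff dvd_triv_left)
  then show "int l ^ m dvd y"
    unfolding y_def dvd_add_mult_iff_cong_phi_trunc[OF coprime_l_n l_pos] .
  have "?z - phi_trunc l n \<gamma> (Suc m) = int l ^ m * (?u - ?\<phi> + int l * int t)"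
    by (simp add: Unum_eq phi_trunc_Suc algebra_simps)
  moreover have "\<not> int l dvd ?u - ?\<phi> + int l * int t"
    using lead_digit_not_cong[OF assms(1,2), of m] by (simp add: cong_iff_dvd_diff dvd_add_left_iff)
  ultimately have "\<not> int l ^ Suc m dvd ?z - phi_trunc l n \<gamma> (Suc m)"
    using l_pos by (simp add: power_Suc2 del: power_Suc)
  then show "\<not> int l ^ Suc m dvd y"
    unfolding y_def dvd_add_mult_iff_cong_phi_trunc[OF coprime_l_n l_pos] cong_iff_dvd_diff .
qed

section \<open>Exhaustion of the system by the parts\<close>

lemma seq_fin_mem_PC: "seq_fin q l n S \<gamma> m a t \<in> PC q l n"
  unfolding seq_fin_def by (rule PC_memI[OF coprime_q_l coprime_q_n l_pos n_pos]) simp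

lemma seq_inf_mem_PC: "seq_inf q l n \<gamma> \<in> PC q l n"
  unfolding seq_inf_def
proof (rule PC_memI[OF coprime_q_l coprime_q_n l_pos n_pos])
  fix i
  have "(\<gamma> + int n * phi_trunc l n \<gamma> (Suc i)) - (\<gamma> + int n * phi_trunc l n \<gamma> i) =
      int (l ^ i * n) * phi_digit l n \<gamma> i"
    by (simp add: phi_trunc_Suc algebra_simps)
  then show "[\<gamma> + int n * phi_trunc l n \<gamma> (Suc i) = \<gamma> + int n * phi_trunc l n \<gamma> i] (mod int (l ^ i * n))"
    by (simp only: cong_iff_dvd_diff dvd_triv_left)
qed

lemma cong_power_tau: "[y * int q ^ (tau y * j) = y] (mod int n)"
  using cong_iff_cyc_period_dvd[OF coprime_q_n n_pos, of y "tau y * j"] by (simp add: tau_eq)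

text \<open>The powers of \<open>q ^ (tau y * D y)\<close> fill the principal units \<open>1 + l ^ w y * \<int>\<close> modulo every
  power of \<open>l\<close>, so from degree \<open>m + w y\<close> on each coset has only one lift.\<close>

lemma cong_lift:
  assumes y: "int l ^ m dvd y" "\<not> int l ^ Suc m dvd y"
    and xy: "[x = y] (mod int (l ^ (m + w y) * n))"
  shows "\<exists>j. [x = y * int q ^ j] (mod int (l ^ i * n))"
proof -
  obtain y0 where y0: "y = int l ^ m * y0" using y(1) by (elim dvdE)
  then have "\<not> int l dvd y0" using y(2) l_pos by (simp add: mult.commute[of "int l"])
  then have "coprime y0 (int l ^ i)"
    using prime_l prime_imp_coprime[of "int l" y0] by (simp add: coprime_commute)
  then obtain b where b: "[y0 * b = 1] (mod int l ^ i)" by (metis cong_solve_coprime_int)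
  obtain c where c: "x = y + int (l ^ (m + w y) * n) * c"
    using xy by (metis cong_iff_lin cong_sym)
  define e where "e = int l ^ w y * int n * c"
  have x: "x = int l ^ m * (y0 + e)" by (simp add: c y0 e_def power_add algebra_simps)
  \<comment> \<open>After removal of \<open>l ^ m\<close>, \<open>1 + e * b\<close> stands for the
    quotient of \<open>x\<close> by \<open>y\<close>, with \<open>b\<close> inverse to
    \<open>y0\<close>.\<close>
  have "[1 + e * b = 1] (mod int l ^ w y)" by (simp add: e_def cong_iff_dvd_diff mult.assoc)
  then obtain j where j: "[1 + e * b = (int q ^ (tau y * D y)) ^ j] (mod int l ^ i)"
    using pow.power_surj by blast
  have "[y0 * (int q ^ (tau y * D y)) ^ j = y0 * (1 + e * b)] (mod int l ^ i)"
    by (intro cong_scalar_left cong_sym[OF j])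
  also have "y0 * (1 + e * b) = y0 + e * (y0 * b)" by (simp add: algebra_simps)
  also have "[\<dots> = y0 + e * 1] (mod int l ^ i)"
    by (intro cong_add cong_refl cong_scalar_left b)
  finally have "[x = y * (int q ^ (tau y * D y)) ^ j] (mod int l ^ i)"
    unfolding x y0 by (simp add: cong_sym cong_scalar_left mult.assoc)
  moreover have "[x = y * (int q ^ (tau y * D y)) ^ j] (mod int n)"
  proof -
    have "[x = y] (mod int n)" using xy by (rule cong_dvd_modulus) simp
    moreover have "[y = y * (int q ^ (tau y * D y)) ^ j] (mod int n)"
      using cong_power_tau[of y "D y * j"] by (simp add: cong_sym mult.assoc flip: power_mult)
    ultimately show ?thesis by (rule cong_trans)
  qed
  ultimately have "[x = y * int q ^ (tau y * D y * j)] (mod int (l ^ i * n))"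
    by (simp add: cong_modulus_iff power_mult)
  then show ?thesis by blast
qed

text \<open>In the finite case the family is normalised at degree \<open>m + w \<gamma>\<close>
  only; unique lifting carries the result upwards and projection downwards.\<close>

lemma mem_PC_part:
  assumes S: "digit_reps \<gamma> S"
    and C: "C \<in> PC q l n" "C 0 = cyc_coset q n \<gamma>"
  shows "\<exists>m. C \<in> PC_part q l n S \<gamma> m"
proof -
  have "\<gamma> mod int n \<in> C 0"
    unfolding C(2) mod_mem_cyc_coset_iff[OF coprime_q_n n_pos] by (rule exI[of _ 0]) simp
  then obtain x where x0: "x 0 = \<gamma> mod int n" and xC: "\<And>i. x i \<in> C i"
    and xS: "\<And>i. [x (Suc i) = x i] (mod int (l ^ i * n))"
    using PC_compatible_choice[OF C(1)] by metis
  note compat = compatible_cong[of x, OF xS]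
  have x\<gamma>: "[x i = \<gamma>] (mod int n)" for i
    using compat[of 0 i] by (simp add: x0)
  have Cx: "C i = cyc_coset q (l ^ i * n) (x i)" for i
    by (rule cyc_coset_of_mem[OF coprime_q_modulus modulus_pos _ xC]) (use C(1) in \<open>simp add: PC_def\<close>)
  show ?thesis
  proof (cases "\<forall>i. int l ^ i dvd x i")
    case True
    have "C i = seq_inf q l n \<gamma> i" for i
      unfolding Cx seq_inf_def
    proof (rule cyc_coset_cong[OF _ coprime_q_modulus modulus_pos])
      have "[x i = \<gamma> + int n * phi_trunc l n \<gamma> i] (mod int l ^ i)"
        using True dvd_add_phi_trunc[OF coprime_l_n l_pos, of i \<gamma>]
        by (simp add: cong_iff_dvd_diff dvd_diff)
      moreover have "[x i = \<gamma> + int n * phi_trunc l n \<gamma> i] (mod int n)"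
        using x\<gamma>[of i] by (simp add: cong_def)
      ultimately show "[x i = \<gamma> + int n * phi_trunc l n \<gamma> i] (mod int (l ^ i * n))"
        by (simp add: cong_modulus_iff)
    qed
    then have "C \<in> PC_part q l n S \<gamma> \<infinity>" by (simp add: PC_part_def fun_eq_iff)
    then show ?thesis by blast
  next
    case False
    \<comment> \<open>Divisibility holds at degree 0, where the power is 1; \<open>m\<close> is a
      degree after which it fails.\<close>
    have "\<exists>m. int l ^ m dvd x m \<and> \<not> int l ^ Suc m dvd x (Suc m)"
    proof (rule ccontr)
      assume neg: "\<nexists>m. int l ^ m dvd x m \<and> \<not> int l ^ Suc m dvd x (Suc m)"
      have "int l ^ i dvd x i" for i by (induction i) (use neg in auto)
      then show False using \<open>\<not> (\<forall>i. int l ^ i dvd x i)\<close> by blast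
    qed
    then obtain m where m: "int l ^ m dvd x m" "\<not> int l ^ Suc m dvd x (Suc m)" by blast
    define K where "K = m + w \<gamma>"
    have w: "0 < w \<gamma>" by (rule pow.w_pos)
    define X where "X = x K"
    have X: "int l ^ m dvd X" "\<not> int l ^ Suc m dvd X" "[X = \<gamma>] (mod int n)"
    proof -
      have "[X = x m] (mod int l ^ m)" "[X = x (Suc m)] (mod int l ^ Suc m)"
        unfolding X_def using compat[of m K] compat[of "Suc m" K] w
        by (simp_all add: K_def cong_modulus_iff del: power_Suc)
      then show "int l ^ m dvd X" "\<not> int l ^ Suc m dvd X" using m by (simp_all only: cong_dvd_iff not_False_eq_True)
      show "[X = \<gamma>] (mod int n)" unfolding X_def by (rule x\<gamma>)
    qed
    obtain X0 where X0: "X = int l ^ m * X0" using X(1) by (elim dvdE)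
    have "\<not> int l dvd X0" using X(2) l_pos by (simp add: X0 mult.commute[of "int l"])
    \<comment> \<open>If \<open>X\<close> is written as \<open>\<gamma> + n * z\<close>, the digit
      of index \<open>m\<close> of \<open>z\<close> deviates from that of
      \<open>- \<gamma> / n\<close> by \<open>X0 / n\<close> modulo \<open>l\<close>; hence the
      inverse \<open>n'\<close>.\<close>
    moreover obtain n' where n': "[int n * n' = 1] (mod int l)"
      using coprime_l_n by (metis cong_solve_coprime_int coprime_commute coprime_int_iff)
    moreover have "\<not> int l dvd n'"
      using n' prime_l by (metis cong_dvd_iff dvd_mult not_prime_unit prime_nat_int_transfer)
    ultimately have "\<not> int l dvd X0 * n'" using prime_l by (simp add: prime_dvd_mult_iff)
    then obtain a j where a: "a \<in> {1..num_reps q l n \<gamma>}"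
      and aj: "[phi_digit l n \<gamma> m + X0 * n' * int q ^ (tau \<gamma> * j) = lead_digit q l n S \<gamma> m a] (mod int l)"
      using lead_digit_cover[OF S] by blast
    let ?u = "lead_digit q l n S \<gamma> m a" and ?\<phi> = "phi_digit l n \<gamma> m" and ?Q = "int q ^ (tau \<gamma> * j)"
    \<comment> \<open>A power of \<open>q ^ tau \<gamma>\<close> fixes the class modulo
      \<open>n\<close>, so \<open>X * ?Q\<close> still has the form
      \<open>\<gamma> + n * z\<close>.\<close>
    have "[X * ?Q = X] (mod int n)"
      using cong_power_tau[of X j] tau_cong[OF X(3)] by simp
    then have "[X * ?Q = \<gamma>] (mod int n)" using X(3) by (rule cong_trans)
    then obtain z where z: "X * ?Q = \<gamma> + int n * z" by (metis cong_iff_lin cong_sym)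
    have "int l ^ m dvd \<gamma> + int n * z" unfolding z[symmetric] using X(1) by simp
    then obtain z' where z': "z = phi_trunc l n \<gamma> m + int l ^ m * z'"
      unfolding dvd_add_mult_iff_cong_phi_trunc[OF coprime_l_n l_pos] by (metis cong_iff_lin cong_sym)
    have "[z' = ?u] (mod int l)"
    proof -
      \<comment> \<open>Replacing the tail \<open>z'\<close> by the digit of the expansion turns
        \<open>z\<close> into the truncation to \<open>m + 1\<close> digits, for which divisibility
        by \<open>l ^ (m + 1)\<close> is known.\<close>
      have "int l ^ m * (X0 * ?Q - int n * (z' - ?\<phi>)) = \<gamma> + int n * phi_trunc l n \<gamma> (Suc m)"
        using z by (simp add: X0 z' phi_trunc_Suc algebra_simps)
      then have "int l ^ m * int l dvd int l ^ m * (X0 * ?Q - int n * (z' - ?\<phi>))"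
        using dvd_add_phi_trunc[OF coprime_l_n l_pos, of "Suc m" \<gamma>] by (simp add: mult.commute)
      then have "[X0 * ?Q = int n * (z' - ?\<phi>)] (mod int l)"
        using l_pos by (simp add: cong_iff_dvd_diff)
      then have "[X0 * ?Q * n' = int n * (z' - ?\<phi>) * n'] (mod int l)" by (rule cong_scalar_right)
      also have "int n * (z' - ?\<phi>) * n' = int n * n' * (z' - ?\<phi>)" by simp
      also have "[\<dots> = 1 * (z' - ?\<phi>)] (mod int l)" by (rule cong_scalar_right[OF n'])
      finally have "[?\<phi> + X0 * ?Q * n' = ?\<phi> + 1 * (z' - ?\<phi>)] (mod int l)"
        by (intro cong_add cong_refl)
      then have "[?\<phi> + X0 * n' * ?Q = z'] (mod int l)" by (simp add: ac_simps)
      then show ?thesis using aj by (simp add: cong_def)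
    qed
    then obtain t' where t': "z' = ?u + int l * t'" by (metis cong_iff_lin cong_sym)
    \<comment> \<open>Degree \<open>K = m + 1 + (w \<gamma> - 1)\<close> sees \<open>t'\<close> only
      modulo \<open>l ^ (w \<gamma> - 1)\<close>, which gives the range of \<open>t\<close> in
      \<open>PC_part\<close>.\<close>
    define t where "t = nat (t' mod int l ^ (w \<gamma> - 1))"
    have t: "int t = t' mod int l ^ (w \<gamma> - 1)" using l_pos by (simp add: t_def)
    then have "int t < int l ^ (w \<gamma> - 1)" using l_pos by simp
    then have t_le: "t \<in> {0..l ^ (w \<gamma> - 1) - 1}" by (simp flip: of_nat_power)
    define y where "y = \<gamma> + int n * (Unum q l n S \<gamma> m a + int l ^ (m + 1) * int t)"
    have y: "int l ^ m dvd y" "\<not> int l ^ Suc m dvd y"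
      unfolding y_def using seq_fin_valuation[OF S a] by blast+
    have wy: "w y = w \<gamma>" by (rule w_cong) (simp add: y_def cong_def)
    have Xy: "[X * ?Q = y] (mod int (l ^ K * n))"
    proof -
      define f where "f = t' div int l ^ (w \<gamma> - 1)"
      have f: "t' = int t + int l ^ (w \<gamma> - 1) * f"
        unfolding t f_def by simp
      have "int l ^ K = int l ^ m * int l * int l ^ (w \<gamma> - 1)"
      proof -
        have "K = m + 1 + (w \<gamma> - 1)" using w by (simp add: K_def)
        then show ?thesis by (simp only: power_add power_one_right)
      qed
      then have "X * ?Q - y = int (l ^ K * n) * f"
        unfolding z y_def Unum_eq z' t' f by (simp add: algebra_simps)
      then show ?thesis by (simp only: cong_iff_dvd_diff dvd_triv_left)
    qed
    have "C = seq_fin q l n S \<gamma> m a t"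
    proof (rule PC_eqI[OF C(1) seq_fin_mem_PC])
      fix i assume i: "K \<le> i"
      have "[x i * ?Q = X * ?Q] (mod int (l ^ K * n))"
        unfolding X_def by (rule cong_scalar_right[OF compat[OF i]])
      then have "[x i * ?Q = y] (mod int (l ^ (m + w y) * n))"
        unfolding wy K_def[symmetric] using Xy by (rule cong_trans)
      then obtain j' where "[x i * ?Q = y * int q ^ j'] (mod int (l ^ i * n))"
        using cong_lift[OF y] by blast
      then have "cyc_coset q (l ^ i * n) (x i * ?Q) = cyc_coset q (l ^ i * n) y"
        by (rule cyc_coset_eqI[OF coprime_q_modulus modulus_pos])
      moreover have "cyc_coset q (l ^ i * n) (x i * ?Q) = cyc_coset q (l ^ i * n) (x i)"
        by (rule cyc_coset_eqI[OF coprime_q_modulus modulus_pos cong_refl])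
      ultimately show "C i = seq_fin q l n S \<gamma> m a t i"
        by (simp add: Cx seq_fin_def y_def)
    qed
    then have "C \<in> PC_part q l n S \<gamma> (enat m)" using a t_le by (auto simp: PC_part_def)
    then show ?thesis by blast
  qed
qed

text \<open>Elements of the coset arise from \<open>y\<close> by powers of \<open>q\<close>, prime
  to \<open>l\<close>, and reduction modulo a multiple of \<open>l ^ i\<close>; neither affects
  divisibility by \<open>l ^ i\<close>.\<close>

lemma ball_cyc_coset_dvd_iff:
  "(\<forall>x\<in>cyc_coset q (l ^ i * n) y. int l ^ i dvd x) \<longleftrightarrow> int l ^ i dvd y"
proof -
  have "int l ^ i dvd (y * int q ^ j) mod int (l ^ i * n) \<longleftrightarrow> int l ^ i dvd y" for j
  proof -
    have "int l ^ i dvd (y * int q ^ j) mod int (l ^ i * n) \<longleftrightarrow> int l ^ i dvd y * int q ^ j"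
      by (rule dvd_mod_iff) simp
    also have "\<dots> \<longleftrightarrow> int l ^ i dvd y"
      using coprime_q_l by (intro coprime_dvd_mult_left_iff) (simp add: coprime_commute)
    finally show ?thesis .
  qed
  then show ?thesis by (simp add: cyc_coset_eq_range[OF coprime_q_modulus modulus_pos])
qed

text \<open>For finite index one integer \<open>y\<close> serves all degrees; the splitting types
  depend only on its class modulo \<open>n\<close> and its valuation \<open>m\<close>.\<close>

lemma PC_part_enatE:
  assumes "digit_reps \<gamma> S"
    and "C \<in> PC_part q l n S \<gamma> (enat m)"
  obtains y where "C = (\<lambda>i. cyc_coset q (l ^ i * n) y)" "[y = \<gamma>] (mod int n)"
    "int l ^ m dvd y" "\<not> int l ^ Suc m dvd y"
proof -
  obtain a t where a: "a \<in> {1..num_reps q l n \<gamma>}" and C: "C = seq_fin q l n S \<gamma> m a t"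
    using assms(2) by (auto simp: PC_part_def)
  show thesis
    by (rule that[OF C[unfolded seq_fin_def] _ seq_fin_valuation[OF assms(1) a]]) (simp_all add: cong_def)
qed

lemma PC_part_infinity: "C \<in> PC_part q l n S \<gamma> \<infinity> \<longleftrightarrow> C = seq_inf q l n \<gamma>"
  by (simp add: PC_part_def)

lemma PC_part_subset: "PC_part q l n S \<gamma> m \<subseteq> PC q l n"
  by (cases m) (auto simp: PC_part_def seq_fin_mem_PC seq_inf_mem_PC)

text \<open>Keeps the parts of different representatives apart.\<close>

lemma PC_part_at_0:
  assumes "C \<in> PC_part q l n S \<gamma> m"
  shows "C 0 = cyc_coset q n \<gamma>"
proof -
  have "cyc_coset q n (\<gamma> + int n * z) = cyc_coset q n \<gamma>" for z
    by (rule cyc_coset_cong[OF _ coprime_q_n n_pos]) (simp add: cong_def)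
  then show ?thesis using assms by (cases m) (auto simp: PC_part_def seq_fin_def seq_inf_def)
qed

text \<open>Reads the index \<open>m\<close> off the sequence itself, which makes parts with
  different indices disjoint.\<close>

lemma PC_part_dvd_iff:
  assumes "digit_reps \<gamma> S"
    and "C \<in> PC_part q l n S \<gamma> m"
  shows "(\<forall>x\<in>C i. int l ^ i dvd x) \<longleftrightarrow> enat i \<le> m"
proof (cases m)
  case (enat k)
  then obtain y where y: "C = (\<lambda>i. cyc_coset q (l ^ i * n) y)" "int l ^ k dvd y" "\<not> int l ^ Suc k dvd y"
    using PC_part_enatE assms by metis
  have "int l ^ i dvd y \<longleftrightarrow> i \<le> k"
    by (metis y(2,3) dvd_trans le_imp_power_dvd not_less_eq_eq)
  then show ?thesis by (simp only: y(1) ball_cyc_coset_dvd_iff enat enat_ord_simps)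
next
  case infinity
  then have "C = seq_inf q l n \<gamma>" using assms(2) by (simp add: PC_part_infinity)
  then show ?thesis
    using dvd_add_phi_trunc[OF coprime_l_n l_pos]
    by (simp only: seq_inf_def ball_cyc_coset_dvd_iff infinity enat_ord_simps)
qed

text \<open>At each degree \<open>i\<close> the representative is divisible by \<open>l ^ i\<close>,
  so the low case always applies and the type never changes.\<close>

lemma seq_inf_types:
  "splitting_at q l n (seq_inf q l n \<gamma>) i \<longleftrightarrow> int l dvd int q ^ tau \<gamma> - 1"
  "semi_splitting_at q l n (seq_inf q l n \<gamma>) i \<longleftrightarrow> \<not> int l dvd int q ^ tau \<gamma> - 1"
proof -
  have "tau (\<gamma> + int n * phi_trunc l n \<gamma> i) = tau \<gamma>" by (rule tau_cong) (simp add: cong_def)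
  then show "splitting_at q l n (seq_inf q l n \<gamma>) i \<longleftrightarrow> int l dvd int q ^ tau \<gamma> - 1"
    "semi_splitting_at q l n (seq_inf q l n \<gamma>) i \<longleftrightarrow> \<not> int l dvd int q ^ tau \<gamma> - 1"
    using splitting_type_low[OF dvd_add_phi_trunc[OF coprime_l_n l_pos, of i \<gamma>]]
    by (simp_all add: splitting_at_def semi_splitting_at_def seq_inf_def)
qed

lemma PC_part_enat_types:
  assumes "digit_reps \<gamma> S"
    and "C \<in> PC_part q l n S \<gamma> (enat m)"
  shows "i \<le> m \<Longrightarrow> splitting_at q l n C i \<longleftrightarrow> int l dvd int q ^ tau \<gamma> - 1"
    and "i \<le> m \<Longrightarrow> semi_splitting_at q l n C i \<longleftrightarrow> \<not> int l dvd int q ^ tau \<gamma> - 1"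
    and "m < i \<Longrightarrow> splitting_at q l n C i \<longleftrightarrow> i < m + w \<gamma>"
    and "m < i \<Longrightarrow> nonsplitting_at q l n C i \<longleftrightarrow> m + w \<gamma> \<le> i"
    and "m < i \<Longrightarrow> \<not> semi_splitting_at q l n C i"
proof -
  obtain y where C: "C = (\<lambda>i. cyc_coset q (l ^ i * n) y)" and y\<gamma>: "[y = \<gamma>] (mod int n)"
    and y: "int l ^ m dvd y" "\<not> int l ^ Suc m dvd y"
    using PC_part_enatE[OF assms] by metis
  note eqs = tau_cong[OF y\<gamma>] w_cong[OF y\<gamma>]
  note defs = splitting_at_def semi_splitting_at_def nonsplitting_at_def C
  have low: "int l ^ i dvd y" if "i \<le> m"
    using y(1) le_imp_power_dvd[OF that] dvd_trans by blast
  show "i \<le> m \<Longrightarrow> splitting_at q l n C i \<longleftrightarrow> int l dvd int q ^ tau \<gamma> - 1"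
    "i \<le> m \<Longrightarrow> semi_splitting_at q l n C i \<longleftrightarrow> \<not> int l dvd int q ^ tau \<gamma> - 1"
    unfolding defs eqs(1)[symmetric] using splitting_type_low low by blast+
  show "m < i \<Longrightarrow> splitting_at q l n C i \<longleftrightarrow> i < m + w \<gamma>"
    "m < i \<Longrightarrow> nonsplitting_at q l n C i \<longleftrightarrow> m + w \<gamma> \<le> i"
    "m < i \<Longrightarrow> \<not> semi_splitting_at q l n C i"
    unfolding defs eqs(2)[symmetric] using splitting_type_high[OF y] by blast+
qed

lemma PC_decomposition:
  assumes R: "coset_reps q n R"
    and S: "\<And>\<gamma>. \<gamma> \<in> R \<Longrightarrow> digit_reps \<gamma> (S \<gamma>)"
  shows "PC q l n = (\<Union>\<gamma>\<in>R. \<Union>m. PC_part q l n (S \<gamma>) \<gamma> m)"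
    and "disjoint_family_on (\<lambda>\<gamma>. \<Union>m. PC_part q l n (S \<gamma>) \<gamma> m) R"
    and "\<gamma> \<in> R \<Longrightarrow> disjoint_family (PC_part q l n (S \<gamma>) \<gamma>)"
proof -
  show "PC q l n = (\<Union>\<gamma>\<in>R. \<Union>m. PC_part q l n (S \<gamma>) \<gamma> m)"
  proof
    show "PC q l n \<subseteq> (\<Union>\<gamma>\<in>R. \<Union>m. PC_part q l n (S \<gamma>) \<gamma> m)"
    proof
      fix C assume C: "C \<in> PC q l n"
      then have "C 0 \<in> cyc_cosets q (l ^ 0 * n)" unfolding PC_def by blast
      then have "C 0 \<in> cyc_coset q n ` R" using R by (simp add: coset_reps_def bij_betw_def)
      then obtain \<gamma> where \<gamma>: "\<gamma> \<in> R" "C 0 = cyc_coset q n \<gamma>" by blast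
      obtain m where "C \<in> PC_part q l n (S \<gamma>) \<gamma> m"
        using mem_PC_part[OF S[OF \<gamma>(1)] C \<gamma>(2)] by (elim exE)
      with \<gamma>(1) show "C \<in> (\<Union>\<gamma>\<in>R. \<Union>m. PC_part q l n (S \<gamma>) \<gamma> m)" by blast
    qed
    show "(\<Union>\<gamma>\<in>R. \<Union>m. PC_part q l n (S \<gamma>) \<gamma> m) \<subseteq> PC q l n"
      by (intro UN_least PC_part_subset)
  qed
  show "disjoint_family_on (\<lambda>\<gamma>. \<Union>m. PC_part q l n (S \<gamma>) \<gamma> m) R"
    unfolding disjoint_family_on_def
  proof (intro ballI impI)
    fix \<gamma> \<delta> assume "\<gamma> \<in> R" "\<delta> \<in> R" "\<gamma> \<noteq> \<delta>"
    then have "cyc_coset q n \<gamma> \<noteq> cyc_coset q n \<delta>"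
      using R unfolding coset_reps_def bij_betw_def by (metis inj_onD)
    moreover have "C 0 = cyc_coset q n \<epsilon>" if "C \<in> (\<Union>m. PC_part q l n (S \<epsilon>) \<epsilon> m)" for C \<epsilon>
      using that PC_part_at_0 by blast
    ultimately show "(\<Union>m. PC_part q l n (S \<gamma>) \<gamma> m) \<inter> (\<Union>m. PC_part q l n (S \<delta>) \<delta> m) = {}"
      by (metis disjoint_iff)
  qed
  show "disjoint_family (PC_part q l n (S \<gamma>) \<gamma>)" if "\<gamma> \<in> R"
    unfolding disjoint_family_on_def
  proof (intro ballI impI equals0I)
    fix m k C assume "m \<noteq> k" and C: "C \<in> PC_part q l n (S \<gamma>) \<gamma> m \<inter> PC_part q l n (S \<gamma>) \<gamma> k"
    have le: "(\<forall>x\<in>C i. int l ^ i dvd x) \<longleftrightarrow> enat i \<le> j" if "j \<in> {m, k}" for i j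
      by (rule PC_part_dvd_iff[OF S[OF \<open>\<gamma> \<in> R\<close>]]) (use C that in blast)
    have "enat i \<le> m \<longleftrightarrow> enat i \<le> k" for i
      using le[of m i] le[of k i] by blast
    then have "m = k" by (rule enat_eqI)
    with \<open>m \<noteq> k\<close> show False by blast
  qed
qed

text \<open>Being splitting or semi-splitting at every degree can be read pointwise or uniformly;
  the cycle \<open>?I \<subseteq> ?B \<subseteq> ?A \<subseteq> ?I\<close> shows that the readings
  agree.\<close>

lemma Union_PC_part_infinity:
  assumes R: "coset_reps q n R"
    and S: "\<And>\<gamma>. \<gamma> \<in> R \<Longrightarrow> digit_reps \<gamma> (S \<gamma>)"
  shows "(\<Union>\<gamma>\<in>R. PC_part q l n (S \<gamma>) \<gamma> \<infinity>) =
      {C \<in> PC q l n. \<forall>i. splitting_at q l n C i \<or> semi_splitting_at q l n C i}" (is "?I = ?A")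
    and "(\<Union>\<gamma>\<in>R. PC_part q l n (S \<gamma>) \<gamma> \<infinity>) =
      {C \<in> PC q l n. (\<forall>i. splitting_at q l n C i) \<or> (\<forall>i. semi_splitting_at q l n C i)}" (is "_ = ?B")
proof -
  have "?I \<subseteq> ?B"
    by (auto simp: PC_part_infinity seq_inf_mem_PC seq_inf_types)
  moreover have "?B \<subseteq> ?A" by blast
  moreover have "?A \<subseteq> ?I"
  proof
    fix C assume C: "C \<in> ?A"
    then obtain \<gamma> m where m: "\<gamma> \<in> R" "C \<in> PC_part q l n (S \<gamma>) \<gamma> m"
      using PC_decomposition(1)[OF R S] by blast
    show "C \<in> ?I"
    proof (cases m)
      case (enat k)
      \<comment> \<open>At degree \<open>k + w \<gamma>\<close> a sequence of finite index
        \<open>k\<close> is neither splitting nor semi-splitting.\<close>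
      have "k < k + w \<gamma>" using pow.w_pos by simp
      then have "\<not> splitting_at q l n C (k + w \<gamma>)" "\<not> semi_splitting_at q l n C (k + w \<gamma>)"
        using PC_part_enat_types(3,5)[OF S[OF m(1)] m(2)[unfolded enat], of "k + w \<gamma>"] by blast+
      then show ?thesis using C by blast
    qed (use m in auto)
  qed
  ultimately show "?I = ?A" "?I = ?B" by blast+
qed

end

text \<open>If \<open>l\<close> does not divide \<open>q ^ tau - 1\<close>, degree \<open>m\<close>
  is semi-splitting, against the bound \<open>m - 1\<close> of the informal statement:
  \<open>l ^ m\<close> divides the representatives there, so the coset still has size
  \<open>tau\<close>. The splitting range is \<open>m < i < m + v\<close>, empty for
  \<open>v = 1\<close>.\<close>

theorem theorem5p3:
  fixes p e q l n :: nat and R :: "int set" and S :: "int \<Rightarrow> int set"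
  assumes "prime p" and "e > 0" and "q = p ^ e"
    and "prime l" and "odd l" and "l \<noteq> p"
    and "n > 0" and "\<not> p dvd n" and "\<not> l dvd n"
    and "coset_reps q n R"
    and "\<And>\<gamma>. \<gamma> \<in> R \<Longrightarrow> \<not> int l dvd int q ^ csize q n \<gamma> - 1 \<Longrightarrow>
           unit_quot_reps l (int q ^ csize q n \<gamma>) (S \<gamma>)"
  shows
    "PC q l n = (\<Union>\<gamma>\<in>R. \<Union>m::enat. PC_part q l n (S \<gamma>) \<gamma> m)
     \<and> disjoint_family_on (\<lambda>\<gamma>. \<Union>m::enat. PC_part q l n (S \<gamma>) \<gamma> m) R
     \<and> (\<forall>\<gamma>\<in>R. disjoint_family (\<lambda>m::enat. PC_part q l n (S \<gamma>) \<gamma> m))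
     \<and> (\<Union>\<gamma>\<in>R. PC_part q l n (S \<gamma>) \<gamma> \<infinity>) =
          {C \<in> PC q l n. \<forall>i. splitting_at q l n C i \<or> semi_splitting_at q l n C i}
     \<and> (\<Union>\<gamma>\<in>R. PC_part q l n (S \<gamma>) \<gamma> \<infinity>) =
          {C \<in> PC q l n. (\<forall>i. splitting_at q l n C i) \<or> (\<forall>i. semi_splitting_at q l n C i)}
     \<and> (\<forall>\<gamma>\<in>R. int l dvd int q ^ csize q n \<gamma> - 1 \<longrightarrow>
          (\<forall>m::nat. \<forall>C\<in>PC_part q l n (S \<gamma>) \<gamma> (enat m). \<forall>i.
             (i < m + vexp q l n \<gamma> \<longrightarrow> splitting_at q l n C i) \<and>
             (i \<ge> m + vexp q l n \<gamma> \<longrightarrow> nonsplitting_at q l n C i)))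
     \<and> (\<forall>\<gamma>\<in>R. \<not> int l dvd int q ^ csize q n \<gamma> - 1 \<longrightarrow>
          (\<forall>m::nat. \<forall>C\<in>PC_part q l n (S \<gamma>) \<gamma> (enat m). \<forall>i.
             (i \<le> m \<longrightarrow> semi_splitting_at q l n C i) \<and>
             (m < i \<and> i < m + vexp q l n \<gamma> \<longrightarrow> splitting_at q l n C i) \<and>
             (i \<ge> m + vexp q l n \<gamma> \<longrightarrow> nonsplitting_at q l n C i)))"
proof -
  have "1 < q" unfolding assms(3) using assms(1,2) by (intro one_less_power prime_gt_1_nat)
  moreover have "coprime p l" using assms(1,4,6) by (intro primes_coprime) auto
  moreover have "coprime p n" using assms(1,8) by (rule prime_imp_coprime)
  moreover have "coprime l n" using assms(4,9) by (rule prime_imp_coprime)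
  ultimately interpret cyclotomic_tower q l n
    using assms(3,4,5,7) by unfold_locales simp_all
  have S: "digit_reps \<gamma> (S \<gamma>)" if "\<gamma> \<in> R" for \<gamma>
    using assms(11)[OF that] by (auto simp: digit_reps_def)
  have high: "m < i" if "m + w \<gamma> \<le> i" for m i \<gamma> using that pow.w_pos[of \<gamma>] by linarith
  have low: "splitting_at q l n C i"
    if "\<gamma> \<in> R" "int l dvd int q ^ tau \<gamma> - 1" "C \<in> PC_part q l n (S \<gamma>) \<gamma> (enat m)" "i < m + w \<gamma>" for \<gamma> m C i
    using PC_part_enat_types(1,3)[OF S[OF that(1)] that(3)] that(2,4) by (cases "i \<le> m") auto
  have semi: "semi_splitting_at q l n C i"
    if "\<gamma> \<in> R" "\<not> int l dvd int q ^ tau \<gamma> - 1" "C \<in> PC_part q l n (S \<gamma>) \<gamma> (enat m)" "i \<le> m" for \<gamma> m C i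
    using PC_part_enat_types(2)[OF S[OF that(1)] that(3)] that(2,4) by blast
  have mid: "splitting_at q l n C i"
    if "\<gamma> \<in> R" "C \<in> PC_part q l n (S \<gamma>) \<gamma> (enat m)" "m < i \<and> i < m + w \<gamma>" for \<gamma> m C i
    using PC_part_enat_types(3)[OF S[OF that(1)] that(2)] that(3) by blast
  have non: "nonsplitting_at q l n C i"
    if "\<gamma> \<in> R" "C \<in> PC_part q l n (S \<gamma>) \<gamma> (enat m)" "m + w \<gamma> \<le> i" for \<gamma> m C i
    using PC_part_enat_types(4)[OF S[OF that(1)] that(2) high[OF that(3)]] that(3) by blast
  show ?thesis
    by (intro conjI ballI allI impI)
      (rule PC_decomposition[OF assms(10) S] Union_PC_part_infinity[OF assms(10) S] low semi mid non;
        assumption)+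
qed

end
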